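(* Let $k\ge2$ and let $\varphi_k:(\mathbb{K}^{2k-2},0)\to(\mathbb{K}^{2k-1},0)$ be the minimal cross cap mapping of multiplicity $k$ (the normal form of a corank $1$ minimal stable map of multiplicity $k$). Let $\xi$ be a vector field on $(\mathbb{K}^{2k-1},0)$ that is liftable over $\varphi_k$ and whose components are polynomials. Then there exist polynomials $g_e$ and $g_{i,j}$ ($1\le i\le 3$, $1\le j\le k-1$) in the coordinates of $\mathbb{K}^{2k-1}$ such that \[ \xi=g_e\,\xi_e+\sum_{i=1}^3\sum_{j=1}^{k-1}g_{i,j}\,\xi^i_j, \] where $\xi_e$ is the Euler vector field and $\xi^1_j,\xi^2_j,\xi^3_j$ are the three explicit families of vector fields given in the context.
   Context: $\mathbb{K}=\mathbb{R}$ or $\mathbb{C}$; maps, functions and vector fields are germs that are smooth (infinitely differentiable) or $\mathbb{K}$-analytic. The minimal cross cap mapping of multiplicity $k\ge2$ is $\varphi_k:(\mathbb{K}^{2k-2},0)\to(\mathbb{K}^{2k-1},0)$, \[ \varphi_k(u_1,\ldots,u_{k-2},v_1,\ldots,v_{k-1},y)=\Big(u_1,\ldots,u_{k-2},v_1,\ldots,v_{k-1},\,y^k+\sum_{i=1}^{k-2}u_iy^i,\ \sum_{i=1}^{k-1}v_iy^i\Big). \] The coordinates on the target are, in order, $U_1,\dots,U_{k-2},V_1,\dots,V_{k-1},W_1,W_2$; components of vector fields are listed in this order. A vector field germ $\xi$ on $(\mathbb{K}^p,0)$ is liftable over $f:(\mathbb{K}^n,0)\to(\mathbb{K}^p,0)$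 if there is a vector field germ $\eta$ on $(\mathbb{K}^n,0)$ with $df\circ\eta=\xi\circ f$. Euler vector field: $\xi_e=((k-1)U_1,(k-2)U_2,\dots,2U_{k-2},(k-1)V_1,(k-2)V_2,\dots,V_{k-1},kW_1,kW_2)^T$. Dummy variable convention: $U_{k-1}=V_k=0$, $U_k=1$, and $U_r=V_r=0$ for $r\le 0$ and for $r>k$. Empty sums are $0$. For $1\le f\le3$, $1\le j\le k-1$, $\xi^f_j=(A^f_{1,j},\dots,A^f_{k-2,j},B^f_{1,j},\dots,B^f_{k-1,j},C^f_{1,j},C^f_{2,j})^T$, where (for $1\le i\le k-2$ in the $A$'s and $1\le i\le k-1$ in the $B$'s): First family: $A_{i,j}^1=(k-i)(k-j)U_iU_j$; $B_{i,j}^1=k\sum_{r=1}^{i-1}U_{i+j-r}V_r-k\sum_{r=1}^iU_rV_{i+j-r}-(i-1)(k-j)U_jV_i+kV_{i+j}W_1-kU_{i+j}W_2$; $C_{1,j}^1=k(k-j)U_jW_1$; $C_{2,j}^1=-kV_jW_1+(k-j)U_jW_2$. Second family: $A_{i,j}^2=-k(k+i-j+1)U_{k+i-j+1}W_1+k\sum_{r=1}^i(k+i-j-2r+1)U_rU_{k+i-j-r+1}-j(i+1)U_{i+1}U_{k-j}$; $B_{i,j}^2=-k(k+i-j+1)V_{k+i-j+1}W_1+k\sum_{r=1}^i(k+i-j-r+1)U_rV_{k+i-j-r+1}-k\sum_{r=1}^irU_{k+i-j-r+1}V_r-j(i+1)U_{k-j}V_{i+1}$; $C_{1,j}^2=k(k-j+1)U_{k-j+1}W_1+jU_1U_{k-j}$;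 $C_{2,j}^2=k(k-j+1)V_{k-j+1}W_1+jV_1U_{k-j}$. Third family: $A_{i,j}^3=-k(k+i-j+1)U_{k+i-j+1}W_2+k\sum_{r=1}^i(k+i-j-r+1)U_{k+i-j-r+1}V_r-k\sum_{r=1}^irU_rV_{k+i-j-r+1}-k(i+1)U_{i+1}V_{k-j}$; $B_{i,j}^3=-k(k+i-j+1)V_{k+i-j+1}W_2+k\sum_{r=1}^i(k+i-j-2r+1)V_rV_{k+i-j-r+1}-k(i+1)V_{i+1}V_{k-j}$; $C_{1,j}^3=k(k-j+1)U_{k-j+1}W_2+kU_1V_{k-j}$; $C_{2,j}^3=k(k-j+1)V_{k-j+1}W_2+kV_1V_{k-j}$. *)

theory Defs
  imports "HOL-Analysis.Analysis"
begin

text \<open>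
  The ground field \<open>\<K>\<close> is a type of class \<^class>\<open>real_normed_field\<close>. By the Gelfand--Mazur
  theorem the types of this class are, up to isomorphism, exactly \<^typ>\<open>real\<close> and \<^typ>\<open>complex\<close>.

  Coordinates are numbered from 1, and \<open>\<K>\<^sup>n\<close> is the set of functions vanishing outside
  \<open>{1..n}\<close>. As a subspace of the product space \<^typ>\<open>nat \<Rightarrow> 'a\<close> it carries the usual topology.
\<close>

definition Kn :: "nat \<Rightarrow> (nat \<Rightarrow> 'a::real_normed_field) set" where
  "Kn n = {x. \<forall>i. i \<notin> {1..n} \<longrightarrow> x i = 0}"

abbreviation origin :: "nat \<Rightarrow> 'a::real_normed_field" where
  "origin \<equiv> (\<lambda>_. 0)"

definition nbhd0 :: "nat \<Rightarrow> (nat \<Rightarrow> 'a::real_normed_field) set \<Rightarrow> bool" where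
  "nbhd0 n S \<longleftrightarrow> openin (top_of_set (Kn n)) S \<and> origin \<in> S"


text \<open>Germs at the origin are represented by functions; only the values near the origin in
  \<open>\<K>\<^sup>n\<close> matter. Derivatives are taken over \<open>\<K>\<close>, so for \<open>\<K> = \<complex>\<close> smooth means holomorphic.\<close>

fun Cr_on :: "nat \<Rightarrow> nat \<Rightarrow> (nat \<Rightarrow> 'a::real_normed_field) set \<Rightarrow> ((nat \<Rightarrow> 'a) \<Rightarrow> 'a) \<Rightarrow> bool" where
  "Cr_on n 0 S f \<longleftrightarrow> continuous_on S f"
| "Cr_on n (Suc r) S f \<longleftrightarrow> continuous_on S f \<and>
     (\<exists>f'. \<forall>j\<in>{1..n}.
        (\<forall>x\<in>S. ((\<lambda>t. f (x(j := t))) has_field_derivative f' j x) (at (x j))) \<and>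
        Cr_on n r S (f' j))"

definition smooth_germ :: "nat \<Rightarrow> ((nat \<Rightarrow> 'a::real_normed_field) \<Rightarrow> 'a) \<Rightarrow> bool" where
  "smooth_germ n f \<longleftrightarrow> (\<exists>S. nbhd0 n S \<and> (\<forall>r. Cr_on n r S f))"

definition multi_indices :: "nat \<Rightarrow> (nat \<Rightarrow> nat) set" where
  "multi_indices n = {\<alpha>. \<forall>i. i \<notin> {1..n} \<longrightarrow> \<alpha> i = 0}"

definition analytic_germ :: "nat \<Rightarrow> ((nat \<Rightarrow> 'a::real_normed_field) \<Rightarrow> 'a) \<Rightarrow> bool" where
  "analytic_germ n f \<longleftrightarrow>
     (\<exists>S c. nbhd0 n S \<and>
        (\<forall>x\<in>S. ((\<lambda>\<alpha>. c \<alpha> * (\<Prod>i=1..n. x i ^ \<alpha> i)) has_sum f x) (multi_indices n)))"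

definition partial_deriv ::
    "nat \<Rightarrow> ((nat \<Rightarrow> 'a::real_normed_field) \<Rightarrow> 'a) \<Rightarrow> (nat \<Rightarrow> 'a) \<Rightarrow> 'a" where
  "partial_deriv j f x = deriv (\<lambda>t. f (x(j := t))) (x j)"

text \<open>The parameter \<open>reg\<close> is the category of germs: \<^const>\<open>smooth_germ\<close> or \<^const>\<open>analytic_germ\<close>.\<close>

definition vector_field_germ ::
    "(nat \<Rightarrow> ((nat \<Rightarrow> 'a::real_normed_field) \<Rightarrow> 'a) \<Rightarrow> bool) \<Rightarrow> nat \<Rightarrow>
     ((nat \<Rightarrow> 'a) \<Rightarrow> nat \<Rightarrow> 'a) \<Rightarrow> bool" where
  "vector_field_germ reg n \<eta> \<longleftrightarrow> (\<forall>j\<in>{1..n}. reg n (\<lambda>x. \<eta> x j))"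

definition liftable ::
    "(nat \<Rightarrow> ((nat \<Rightarrow> 'a::real_normed_field) \<Rightarrow> 'a) \<Rightarrow> bool) \<Rightarrow> nat \<Rightarrow> nat \<Rightarrow>
     ((nat \<Rightarrow> 'a) \<Rightarrow> nat \<Rightarrow> 'a) \<Rightarrow> ((nat \<Rightarrow> 'a) \<Rightarrow> nat \<Rightarrow> 'a) \<Rightarrow> bool" where
  "liftable reg n p f \<xi> \<longleftrightarrow> vector_field_germ reg p \<xi> \<and>
     (\<exists>\<eta>. vector_field_germ reg n \<eta> \<and>
       (\<exists>S. nbhd0 n S \<and>
         (\<forall>x\<in>S. \<forall>i\<in>{1..p}.
            (\<Sum>j=1..n. partial_deriv j (\<lambda>z. f z i) x * \<eta> x j) = \<xi> (f x) i)))"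

text \<open>Since \<open>\<K>\<close> is infinite, polynomials in \<open>n\<close> variables are identified with polynomial functions.
  A polynomial function on \<open>\<K>\<^sup>n\<close> is taken with its canonical extension, depending only on the
  coordinates \<open>1,\<dots>,n\<close>, to all of \<^typ>\<open>nat \<Rightarrow> 'a\<close>.\<close>

inductive polynomial_fun :: "nat \<Rightarrow> ((nat \<Rightarrow> 'a::real_normed_field) \<Rightarrow> 'a) \<Rightarrow> bool" for n where
  const: "polynomial_fun n (\<lambda>x. c)"
| coord: "i \<in> {1..n} \<Longrightarrow> polynomial_fun n (\<lambda>x. x i)"
| add: "polynomial_fun n f \<Longrightarrow> polynomial_fun n g \<Longrightarrow> polynomial_fun n (\<lambda>x. f x + g x)"
| mult: "polynomial_fun n f \<Longrightarrow> polynomial_fun n g \<Longrightarrow> polynomial_fun n (\<lambda>x. f x * g x)"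


text \<open>Source coordinates: \<open>u\<^sub>1,\<dots>,u\<^sub>k\<^sub>-\<^sub>2,v\<^sub>1,\<dots>,v\<^sub>k\<^sub>-\<^sub>1,y\<close>. Target coordinates:
  \<open>U\<^sub>1,\<dots>,U\<^sub>k\<^sub>-\<^sub>2,V\<^sub>1,\<dots>,V\<^sub>k\<^sub>-\<^sub>1,W\<^sub>1,W\<^sub>2\<close>. The next function assembles an element of
  \<open>\<K>\<^sup>2\<^sup>k\<^sup>-\<^sup>1\<close> from its blocks in this order.\<close>

definition target_vec ::
    "nat \<Rightarrow> (nat \<Rightarrow> 'a::real_normed_field) \<Rightarrow> (nat \<Rightarrow> 'a) \<Rightarrow> 'a \<Rightarrow> 'a \<Rightarrow> nat \<Rightarrow> 'a" where
  "target_vec k a b c1 c2 m =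
     (if m \<in> {1..k-2} then a m
      else if m \<in> {k-1..2*k-3} then b (m - (k-2))
      else if m = 2*k-2 then c1
      else if m = 2*k-1 then c2
      else 0)"

definition cross_cap :: "nat \<Rightarrow> (nat \<Rightarrow> 'a::real_normed_field) \<Rightarrow> nat \<Rightarrow> 'a" where
  "cross_cap k x =
     (let u = (\<lambda>i. x i); v = (\<lambda>i. x (k-2+i)); y = x (2*k-2) in
      target_vec k u v (y^k + (\<Sum>i=1..k-2. u i * y^i)) (\<Sum>i=1..k-1. v i * y^i))"

text \<open>Target coordinates with the dummy variable conventions. In the formulas below all indices
  are integers, so that no subtraction is truncated.\<close>

definition Uc :: "int \<Rightarrow> (nat \<Rightarrow> 'a::real_normed_field) \<Rightarrow> int \<Rightarrow> 'a" where
  "Uc k X r = (if 1 \<le> r \<and> r \<le> k-2 then X (nat r) else if r = k then 1 else 0)"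

definition Vc :: "int \<Rightarrow> (nat \<Rightarrow> 'a::real_normed_field) \<Rightarrow> int \<Rightarrow> 'a" where
  "Vc k X r = (if 1 \<le> r \<and> r \<le> k-1 then X (nat (k-2+r)) else 0)"

definition W1c :: "int \<Rightarrow> (nat \<Rightarrow> 'a::real_normed_field) \<Rightarrow> 'a" where
  "W1c k X = X (nat (2*k-2))"

definition W2c :: "int \<Rightarrow> (nat \<Rightarrow> 'a::real_normed_field) \<Rightarrow> 'a" where
  "W2c k X = X (nat (2*k-1))"

definition euler_field :: "nat \<Rightarrow> (nat \<Rightarrow> 'a::real_normed_field) \<Rightarrow> nat \<Rightarrow> 'a" where
  "euler_field k X =
     target_vec k (\<lambda>i. of_int (int k - int i) * Uc (int k) X (int i))
       (\<lambda>i. of_int (int k - int i) * Vc (int k) X (int i))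
       (of_nat k * W1c (int k) X) (of_nat k * W2c (int k) X)"


definition A1 :: "int \<Rightarrow> int \<Rightarrow> int \<Rightarrow> (nat \<Rightarrow> 'a::real_normed_field) \<Rightarrow> 'a" where
  "A1 k i j X = of_int ((k-i)*(k-j)) * Uc k X i * Uc k X j"

definition B1 :: "int \<Rightarrow> int \<Rightarrow> int \<Rightarrow> (nat \<Rightarrow> 'a::real_normed_field) \<Rightarrow> 'a" where
  "B1 k i j X =
     of_int k * (\<Sum>r=1..i-1. Uc k X (i+j-r) * Vc k X r)
     - of_int k * (\<Sum>r=1..i. Uc k X r * Vc k X (i+j-r))
     - of_int ((i-1)*(k-j)) * Uc k X j * Vc k X i
     + of_int k * Vc k X (i+j) * W1c k X
     - of_int k * Uc k X (i+j) * W2c k X"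

definition C11 :: "int \<Rightarrow> int \<Rightarrow> (nat \<Rightarrow> 'a::real_normed_field) \<Rightarrow> 'a" where
  "C11 k j X = of_int (k*(k-j)) * Uc k X j * W1c k X"

definition C12 :: "int \<Rightarrow> int \<Rightarrow> (nat \<Rightarrow> 'a::real_normed_field) \<Rightarrow> 'a" where
  "C12 k j X = - of_int k * Vc k X j * W1c k X + of_int (k-j) * Uc k X j * W2c k X"


definition A2 :: "int \<Rightarrow> int \<Rightarrow> int \<Rightarrow> (nat \<Rightarrow> 'a::real_normed_field) \<Rightarrow> 'a" where
  "A2 k i j X =
     - of_int (k*(k+i-j+1)) * Uc k X (k+i-j+1) * W1c k X
     + of_int k * (\<Sum>r=1..i. of_int (k+i-j-2*r+1) * Uc k X r * Uc k X (k+i-j-r+1))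
     - of_int (j*(i+1)) * Uc k X (i+1) * Uc k X (k-j)"

definition B2 :: "int \<Rightarrow> int \<Rightarrow> int \<Rightarrow> (nat \<Rightarrow> 'a::real_normed_field) \<Rightarrow> 'a" where
  "B2 k i j X =
     - of_int (k*(k+i-j+1)) * Vc k X (k+i-j+1) * W1c k X
     + of_int k * (\<Sum>r=1..i. of_int (k+i-j-r+1) * Uc k X r * Vc k X (k+i-j-r+1))
     - of_int k * (\<Sum>r=1..i. of_int r * Uc k X (k+i-j-r+1) * Vc k X r)
     - of_int (j*(i+1)) * Uc k X (k-j) * Vc k X (i+1)"

definition C21 :: "int \<Rightarrow> int \<Rightarrow> (nat \<Rightarrow> 'a::real_normed_field) \<Rightarrow> 'a" where
  "C21 k j X =
     of_int (k*(k-j+1)) * Uc k X (k-j+1) * W1c k X + of_int j * Uc k X 1 * Uc k X (k-j)"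

definition C22 :: "int \<Rightarrow> int \<Rightarrow> (nat \<Rightarrow> 'a::real_normed_field) \<Rightarrow> 'a" where
  "C22 k j X =
     of_int (k*(k-j+1)) * Vc k X (k-j+1) * W1c k X + of_int j * Vc k X 1 * Uc k X (k-j)"


definition A3 :: "int \<Rightarrow> int \<Rightarrow> int \<Rightarrow> (nat \<Rightarrow> 'a::real_normed_field) \<Rightarrow> 'a" where
  "A3 k i j X =
     - of_int (k*(k+i-j+1)) * Uc k X (k+i-j+1) * W2c k X
     + of_int k * (\<Sum>r=1..i. of_int (k+i-j-r+1) * Uc k X (k+i-j-r+1) * Vc k X r)
     - of_int k * (\<Sum>r=1..i. of_int r * Uc k X r * Vc k X (k+i-j-r+1))
     - of_int (k*(i+1)) * Uc k X (i+1) * Vc k X (k-j)"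

definition B3 :: "int \<Rightarrow> int \<Rightarrow> int \<Rightarrow> (nat \<Rightarrow> 'a::real_normed_field) \<Rightarrow> 'a" where
  "B3 k i j X =
     - of_int (k*(k+i-j+1)) * Vc k X (k+i-j+1) * W2c k X
     + of_int k * (\<Sum>r=1..i. of_int (k+i-j-2*r+1) * Vc k X r * Vc k X (k+i-j-r+1))
     - of_int (k*(i+1)) * Vc k X (i+1) * Vc k X (k-j)"

definition C31 :: "int \<Rightarrow> int \<Rightarrow> (nat \<Rightarrow> 'a::real_normed_field) \<Rightarrow> 'a" where
  "C31 k j X =
     of_int (k*(k-j+1)) * Uc k X (k-j+1) * W2c k X + of_int k * Uc k X 1 * Vc k X (k-j)"

definition C32 :: "int \<Rightarrow> int \<Rightarrow> (nat \<Rightarrow> 'a::real_normed_field) \<Rightarrow> 'a" where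
  "C32 k j X =
     of_int (k*(k-j+1)) * Vc k X (k-j+1) * W2c k X + of_int k * Vc k X 1 * Vc k X (k-j)"


text \<open>\<open>family_field k f j\<close> is \<open>\<xi>\<^sup>f\<^sub>j\<close>, for \<open>f\<close> in \<open>{1..3}\<close>.\<close>

definition family_field ::
    "nat \<Rightarrow> nat \<Rightarrow> nat \<Rightarrow> (nat \<Rightarrow> 'a::real_normed_field) \<Rightarrow> nat \<Rightarrow> 'a" where
  "family_field k f j X =
     (let k' = int k; j' = int j in
      if f = 1 then target_vec k (\<lambda>i. A1 k' (int i) j' X) (\<lambda>i. B1 k' (int i) j' X)
                      (C11 k' j' X) (C12 k' j' X)
      else if f = 2 then target_vec k (\<lambda>i. A2 k' (int i) j' X) (\<lambda>i. B2 k' (int i) j' X)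
                      (C21 k' j' X) (C22 k' j' X)
      else target_vec k (\<lambda>i. A3 k' (int i) j' X) (\<lambda>i. B3 k' (int i) j' X)
                      (C31 k' j' X) (C32 k' j' X))"

end

(*
  Write p = y^k + sum U_i y^i and q = sum V_i y^i. A vector field with components (a, b, c1, c2)
  is encoded by the pair of polynomials f1 = c1 - sum a_i y^i and f2 = c2 - sum b_i y^i in y.
  A lift with y-component h means (f1, f2) = h (p', q') after substituting W1 = p and W2 = q.
  Since p' is linear in U_1 (or equal to 2 y, if k = 2), a polynomial field has a polynomial h,
  so that (f1, f2) = h (p', q') + (W1 - p) (e1, e2) + (W2 - q) (g1, g2) with polynomials e, g.

  Let E_j, D_j be the polynomial parts of p / y^j, q / y^j. Modulo W1 - p, the Euler field has h = y
  and the second family has h = k E_(k-j) + const; for j = 1 this is k y, so that a combination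
  with the Euler field gives (0, W2 - q), and the first family supplies all (0, E_j (W2 - q)).
  The third family gives k D_(k-j) (p', q') - k (q - W2) (F_j, G_j), F_j = k y^(j-1) + lower terms.
  Polynomials modulo p - W1 have degree below k in y, so triangularity yields, in this order:
  every (0, (W2 - q) g) lies in the span; (W2 - q) g in the first component can be traded for a
  multiple of (p', q'); and a multiplier h can be replaced by one that does not depend on y.
  As f1 has degree at most k - 2 while p' has degree k - 1, this last h is zero.
*)
theory Submission
  imports Defs "HOL-Computational_Algebra.Polynomial"
begin

section \<open>Polynomials in one variable with polynomial coefficients\<close>

text \<open>For a given field only the y-component of a lift is unknown, since the map is the
  identity in u and v; this is why one multiplier h carries all the information. Computing modulo W1
  - p costs nothing, since p is monic in y and encoded fields have degree below k. But q has the
  variable V_(k-1) as leading coefficient, so multiples of W2 - q have to be produced by the fields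
  themselves. Remainders modulo p - W1 form a free module of rank k, whereas each family has only k
  - 1 members, and the missing one differs each time. The first family supplies leading degrees 1 to
  k - 1, and degree 0 comes from the Euler field. The third supplies 0 to k - 2, and p' itself
  stands in for degree k - 1. The second supplies 1 to k - 1; degree 0 remains as the y-free
  multiplier, which only a degree count excludes. The quadratic sums in the formulas are
  coefficients of Bezoutians, whose antisymmetry makes the products drop to degree below k.\<close>

text \<open>The polynomial ring in the coordinates \<open>X\<^sub>1,\<dots>,X\<^sub>n\<close> and one further variable \<open>y\<close>; keeping \<open>X\<close> as a
  function argument makes the theory of \<^typ>\<open>'a poly\<close> available pointwise.\<close>

inductive poly_family :: "nat \<Rightarrow> ((nat \<Rightarrow> 'a::real_normed_field) \<Rightarrow> 'a poly) \<Rightarrow> bool" for n where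
  const: "poly_family n (\<lambda>X. [:c:])"
| coord: "i \<in> {1..n} \<Longrightarrow> poly_family n (\<lambda>X. [:X i:])"
| var: "poly_family n (\<lambda>X. [:0, 1:])"
| add: "poly_family n F \<Longrightarrow> poly_family n G \<Longrightarrow> poly_family n (\<lambda>X. F X + G X)"
| mult: "poly_family n F \<Longrightarrow> poly_family n G \<Longrightarrow> poly_family n (\<lambda>X. F X * G X)"

lemma polynomial_fun_sum:
  "(\<And>i. i \<in> A \<Longrightarrow> polynomial_fun n (f i)) \<Longrightarrow> polynomial_fun n (\<lambda>X. \<Sum>i\<in>A. f i X)"
  by (induction A rule: infinite_finite_induct)
     (auto intro: polynomial_fun.const polynomial_fun.add)

lemma poly_family_uminus: "poly_family n F \<Longrightarrow> poly_family n (\<lambda>X. - F X)"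
  using poly_family.mult[OF poly_family.const[of n "-1"]] by simp

lemma poly_family_diff:
  "poly_family n F \<Longrightarrow> poly_family n G \<Longrightarrow> poly_family n (\<lambda>X. F X - G X)"
  using poly_family.add[OF _ poly_family_uminus] by fastforce

lemma poly_family_sum:
  "(\<And>i. i \<in> A \<Longrightarrow> poly_family n (F i)) \<Longrightarrow> poly_family n (\<lambda>X. \<Sum>i\<in>A. F i X)"
  using poly_family.const[of n 0]
  by (induction A rule: infinite_finite_induct) (auto intro: poly_family.add)

lemma poly_family_coeff_const: "polynomial_fun n f \<Longrightarrow> poly_family n (\<lambda>X. [:f X:])"
proof (induction rule: polynomial_fun.induct)
  case (add f g)
  then show ?case using poly_family.add[OF add.IH] by simp
next
  case (mult f g)
  then show ?case using poly_family.mult[OF mult.IH] by (simp add: mult.commute)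
qed (auto intro: poly_family.intros)

lemma poly_family_smult:
  "polynomial_fun n f \<Longrightarrow> poly_family n F \<Longrightarrow> poly_family n (\<lambda>X. smult (f X) (F X))"
  using poly_family.mult[OF poly_family_coeff_const, of n f F] by simp

lemma poly_family_monom: "polynomial_fun n f \<Longrightarrow> poly_family n (\<lambda>X. monom (f X) m)"
proof (induction m)
  case 0
  then show ?case by (simp add: monom_0 poly_family_coeff_const)
next
  case (Suc m)
  show ?case
    using poly_family.mult[OF poly_family.var Suc.IH[OF Suc.prems]] by (simp add: monom_Suc)
qed

lemma polynomial_fun_coeff: "poly_family n F \<Longrightarrow> polynomial_fun n (\<lambda>X. coeff (F X) i)"
proof (induction arbitrary: i rule: poly_family.induct)
  case (coord j)
  then show ?case
    by (cases i) (auto intro: polynomial_fun.intros)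
next
  case (mult F G)
  then show ?case
    by (auto simp: coeff_mult intro!: polynomial_fun_sum polynomial_fun.mult)
qed (auto intro: polynomial_fun.intros)

text \<open>The bound is uniform in \<open>X\<close>; it provides the starting degree for the
  induction in \<open>poly_family_divide_monic\<close>.\<close>

lemma poly_family_degree_bound: "poly_family n F \<Longrightarrow> \<exists>d. \<forall>X. degree (F X) < d"
proof (induction rule: poly_family.induct)
  case (add F G)
  then obtain d e where "\<forall>X. degree (F X) < d" "\<forall>X. degree (G X) < e" by auto
  then have "degree (F X + G X) < max d e" for X
    by (meson degree_add_less less_max_iff_disj)
  then show ?case by blast
next
  case (mult F G)
  then obtain d e where de: "\<forall>X. degree (F X) < d" "\<forall>X. degree (G X) < e" by auto
  have "degree (F X * G X) < d + e" for X
    using degree_mult_le[of "F X" "G X"] de by (meson add_strict_mono le_less_trans)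
  then show ?case by blast
qed auto

text \<open>\<open>F'\<close> arises by putting \<open>t\<close> for the coordinate
  \<open>X i\<close>. For products the quotient comes from F1 F2 - F1' F2' = (F1 - F1') F2 + F1' (F2
  - F2'). Recording \<open>F'\<close> through its values at each \<open>y\<close> allows
  \<open>t\<close> to depend on \<open>y\<close> as well.\<close>

lemma poly_family_subst_ex:
  assumes "poly_family n F" "poly_family n t"
  shows "\<exists>F' G. poly_family n F' \<and> poly_family n G \<and>
           (\<forall>X. F X = F' X + ([:X i:] - t X) * G X) \<and>
           (\<forall>X y. poly (F' X) y = poly (F (X(i := poly (t X) y))) y)"
  using assms(1)
proof (induction rule: poly_family.induct)
  case (const c)
  show ?case
    by (rule exI[of _ "\<lambda>X. [:c:]"], rule exI[of _ "\<lambda>X. [:0:]"])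
       (use poly_family.const[of n 0] in \<open>auto intro: poly_family.const\<close>)
next
  case (coord j)
  show ?case
  proof (cases "i = j")
    case True
    show ?thesis
      by (rule exI[of _ t], rule exI[of _ "\<lambda>X. [:1:]"])
         (use True assms(2) in \<open>auto intro: poly_family.const\<close>)
  next
    case False
    show ?thesis
      by (rule exI[of _ "\<lambda>X. [:X j:]"], rule exI[of _ "\<lambda>X. [:0:]"])
         (use False poly_family.const[of n 0] coord in \<open>auto intro: poly_family.coord\<close>)
  qed
next
  case var
  show ?case
    by (rule exI[of _ "\<lambda>X. [:0,1:]"], rule exI[of _ "\<lambda>X. [:0:]"])
       (use poly_family.const[of n 0] in \<open>auto intro: poly_family.var\<close>)
next
  case (add F1 F2)
  then obtain F1' G1 F2' G2 where *: "poly_family n F1'" "poly_family n G1" "poly_family n F2'" "poly_family n G2"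
    "\<And>X. F1 X = F1' X + ([:X i:] - t X) * G1 X" "\<And>X. F2 X = F2' X + ([:X i:] - t X) * G2 X"
    "\<And>X y. poly (F1' X) y = poly (F1 (X(i := poly (t X) y))) y"
    "\<And>X y. poly (F2' X) y = poly (F2 (X(i := poly (t X) y))) y" by blast
  have **: "F1 X + F2 X = (F1' X + F2' X) + ([:X i:] - t X) * (G1 X + G2 X)" for X
    unfolding *(5,6) by algebra
  show ?case
    by (rule exI[of _ "\<lambda>X. F1' X + F2' X"], rule exI[of _ "\<lambda>X. G1 X + G2 X"])
       (intro conjI allI poly_family.add *(1-4) **, simp only: poly_add *(7,8))
next
  case (mult F1 F2)
  then obtain F1' G1 F2' G2 where *: "poly_family n F1'" "poly_family n G1" "poly_family n F2'" "poly_family n G2"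
    "\<And>X. F1 X = F1' X + ([:X i:] - t X) * G1 X" "\<And>X. F2 X = F2' X + ([:X i:] - t X) * G2 X"
    "\<And>X y. poly (F1' X) y = poly (F1 (X(i := poly (t X) y))) y"
    "\<And>X y. poly (F2' X) y = poly (F2 (X(i := poly (t X) y))) y" by blast
  have **: "F1 X * F2 X = F1' X * F2' X + ([:X i:] - t X) * (G1 X * F2 X + F1' X * G2 X)" for X
    unfolding *(5,6) by algebra
  have "poly_family n (\<lambda>X. G1 X * F2 X + F1' X * G2 X)"
    by (intro poly_family.add poly_family.mult * mult.hyps)
  then show ?case
    by (intro exI[of _ "\<lambda>X. F1' X * F2' X"] exI[of _ "\<lambda>X. G1 X * F2 X + F1' X * G2 X"]
        conjI allI ** poly_family.mult[OF *(1,3)])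
       (simp_all only: poly_mult *(7,8))
qed

lemma poly_family_subst:
  assumes "poly_family n F" "poly_family n t"
  obtains F' G where "poly_family n F'" "poly_family n G"
    "\<And>X. F X = F' X + ([:X i:] - t X) * G X"
    "\<And>X y. poly (F' X) y = poly (F (X(i := poly (t X) y))) y"
proof -
  obtain F' G where *: "poly_family n F' \<and> poly_family n G \<and>
     (\<forall>X. F X = F' X + ([:X i:] - t X) * G X) \<and>
     (\<forall>X y. poly (F' X) y = poly (F (X(i := poly (t X) y))) y)"
    using poly_family_subst_ex[OF assms, of i] by (elim exE) (rule that)
  show thesis
    by (rule that[of F' G]; insert *; elim conjE; (assumption | erule spec | (drule spec, erule spec)))
qed

section \<open>Restriction to curves through the origin\<close>

lemma poly_family_along_line:
  "poly_family n F \<Longrightarrow> \<exists>P. \<forall>t. poly P t = poly (F (\<lambda>i. t * X i)) (t * y)"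
proof (induction rule: poly_family.induct)
  case (const c)
  show ?case by (rule exI[of _ "[:c:]"]) simp
next
  case (coord i)
  show ?case by (rule exI[of _ "[:0, X i:]"]) simp
next
  case var
  show ?case by (rule exI[of _ "[:0, y:]"]) simp
next
  case (add F G)
  then obtain P Q where "\<forall>t. poly P t = poly (F (\<lambda>i. t * X i)) (t * y)"
    "\<forall>t. poly Q t = poly (G (\<lambda>i. t * X i)) (t * y)" by auto
  then show ?case by (intro exI[of _ "P + Q"]) simp
next
  case (mult F G)
  then obtain P Q where "\<forall>t. poly P t = poly (F (\<lambda>i. t * X i)) (t * y)"
    "\<forall>t. poly Q t = poly (G (\<lambda>i. t * X i)) (t * y)" by auto
  then show ?case by (intro exI[of _ "P * Q"]) simp
qed

text \<open>Replaces the identity theorem: a polynomial vanishing on a neighbourhood of the origin is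
  restricted to curves \<open>\<gamma>\<close> on which it becomes a polynomial in \<open>t\<close>.\<close>

lemma infinite_curve_in_nbhd0:
  fixes \<gamma> :: "'a::real_normed_field \<Rightarrow> nat \<Rightarrow> 'a"
  assumes "nbhd0 n S" "\<And>t. \<gamma> t \<in> Kn n" "\<gamma> 0 = origin" "\<And>i. continuous_on UNIV (\<lambda>t. \<gamma> t i)"
  shows "infinite {t. \<gamma> t \<in> S}"
proof -
  obtain T where T: "open T" "S = Kn n \<inter> T" "origin \<in> S"
    using assms(1) unfolding nbhd0_def openin_open by auto
  have "continuous_on UNIV \<gamma>"
    by (rule continuous_on_coordinatewise_then_product) (rule assms(4))
  then have "open (\<gamma> -` T)"
    using T(1) continuous_on_open_vimage[of UNIV \<gamma>] by simp
  moreover have "0 \<in> \<gamma> -` T" using T assms(3) by auto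
  moreover have "{t. \<gamma> t \<in> S} = \<gamma> -` T"
    using assms(2) T(2) by auto
  \<comment> \<open>A normed field has no isolated points, so a nonempty open set of parameters
    cannot be finite.\<close>
  ultimately show ?thesis
    using finite_imp_not_open by (metis empty_iff)
qed

section \<open>Triangular systems and division by a monic polynomial\<close>

lemma degree_less_or_zero: "degree p \<le> m \<Longrightarrow> coeff p m = 0 \<Longrightarrow> degree p < m \<or> p = 0"
  by (cases "degree p = m") auto

text \<open>Elimination from the top degree downwards: subtracting a multiple of \<open>t m\<close>
  removes the coefficient of degree \<open>m\<close>. The pivots \<open>c j\<close> do not depend on
  \<open>X\<close>, so dividing by them keeps the coefficients polynomial in
  \<open>X\<close>.\<close>

lemma triangular_closure:
  assumes "poly_family n F" "\<And>X. degree (F X) < m \<or> F X = 0"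
    and t: "\<And>j. j < m \<Longrightarrow> poly_family n (t j)" "\<And>j X. j < m \<Longrightarrow> degree (t j X) \<le> j"
      "\<And>j X. j < m \<Longrightarrow> coeff (t j X) j = c j" "\<And>j. j < m \<Longrightarrow> c j \<noteq> 0"
    and Q: "\<And>j. j < m \<Longrightarrow> Q (t j)" "Q (\<lambda>X. 0)"
      "\<And>F G. Q F \<Longrightarrow> Q G \<Longrightarrow> Q (\<lambda>X. F X + G X)"
      "\<And>f F. polynomial_fun n f \<Longrightarrow> Q F \<Longrightarrow> Q (\<lambda>X. smult (f X) (F X))"
  shows "Q F"
  using assms
proof (induction m arbitrary: F)
  case 0
  then have "F = (\<lambda>X. 0)" by auto
  then show ?case using "0.prems"(8) by simp
next
  case (Suc m)
  define f where "f X = inverse (c m) * coeff (F X) m" for X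
  define G where "G X = F X - smult (f X) (t m X)" for X
  have f: "polynomial_fun n f"
    unfolding f_def using Suc.prems(1)
    by (intro polynomial_fun.mult polynomial_fun.const polynomial_fun_coeff)
  have "poly_family n G"
    unfolding G_def using Suc.prems(1,3) f by (intro poly_family_diff poly_family_smult) auto
  moreover have "degree (G X) < m \<or> G X = 0" for X
  proof -
    have "degree (G X) \<le> m"
      unfolding G_def using Suc.prems(2)[of X] Suc.prems(4)[of m X]
      by (intro degree_diff_le) (auto intro: order.trans[OF degree_smult_le])
    moreover have "coeff (G X) m = 0"
      unfolding G_def f_def using Suc.prems(5)[of m X] Suc.prems(6)[of m] by simp
    ultimately show ?thesis
      by (rule degree_less_or_zero)
  qed
  ultimately have "Q G"
    by (rule Suc.IH) (use Suc.prems in auto)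
  then have "Q (\<lambda>X. G X + smult (f X) (t m X))"
    using Suc.prems(7,9,10) f by blast
  then show ?case by (simp add: G_def)
qed

text \<open>Long division carried out for all \<open>X\<close> at once. With leading coefficient 1
  and constant degree no coefficient is ever divided, so remainder and quotient stay polynomial in
  \<open>X\<close>.\<close>

lemma poly_family_divide_monic:
  assumes "poly_family n F" "poly_family n M" "\<And>X. degree (M X) = k" "\<And>X. coeff (M X) k = 1"
  shows "\<exists>R E. poly_family n R \<and> poly_family n E \<and> (\<forall>X. degree (R X) < k \<or> R X = 0) \<and>
           (\<forall>X. F X = R X + M X * E X)"
proof -
  let ?G = "\<lambda>F. \<exists>R E. poly_family n R \<and> poly_family n E \<and> (\<forall>X. degree (R X) < k \<or> R X = 0) \<and>
           (\<forall>X. F X = R X + M X * E X)"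
  have "poly_family n F \<Longrightarrow> (\<And>X. degree (F X) < d \<or> F X = 0) \<Longrightarrow> ?G F" for d F
  proof (induction d arbitrary: F)
    case 0
    have "poly_family n (\<lambda>X. 0)" using poly_family.const[of n 0] by simp
    then show ?case
      using 0(2) by (intro exI[of _ "\<lambda>X. 0"]) simp
  next
    case (Suc d)
    show ?case
    proof (cases "d < k")
      case True
      have "degree (F X) < k \<or> F X = 0" for X
        using Suc.prems(2)[of X] True by linarith
      moreover have "poly_family n (\<lambda>X. 0)" using poly_family.const[of n 0] by simp
      ultimately show ?thesis
        using Suc.prems(1) by (intro exI[of _ F] exI[of _ "\<lambda>X. 0"]) simp
    next
      case False
      define T where "T X = monom (coeff (F X) d) (d - k)" for X
      have T: "poly_family n T"
        unfolding T_def by (intro poly_family_monom polynomial_fun_coeff Suc.prems)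
      define H where "H X = F X - M X * T X" for X
      have "poly_family n H"
        unfolding H_def by (intro poly_family_diff poly_family.mult Suc.prems assms T)
      moreover have "degree (H X) < d \<or> H X = 0" for X
      proof -
        have "degree (M X * T X) \<le> d"
          using degree_mult_le[of "M X" "T X"] degree_monom_le[of "coeff (F X) d" "d - k"] False assms(3)[of X]
          unfolding T_def by linarith
        then have "degree (H X) \<le> d"
          unfolding H_def using Suc.prems(2)[of X] by (intro degree_diff_le) auto
        moreover have "coeff (M X * T X) d = coeff (F X) d"
          using False assms(4)[of X] unfolding T_def
          by (simp add: mult.commute[of "M X"] coeff_monom_mult)
        then have "coeff (H X) d = 0" unfolding H_def by simp
        ultimately show ?thesis
          by (rule degree_less_or_zero)
      qed
      ultimately obtain R E where RE: "poly_family n R" "poly_family n E"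
        "\<forall>X. degree (R X) < k \<or> R X = 0" "\<forall>X. H X = R X + M X * E X"
        using Suc.IH by blast
      have "\<forall>X. F X = R X + M X * (E X + T X)"
      proof
        fix X
        show "F X = R X + M X * (E X + T X)"
          using RE(4)[rule_format, of X] unfolding H_def by (simp add: algebra_simps)
      qed
      then show ?thesis using RE T poly_family.add by blast
    qed
  qed
  then show ?thesis
    using poly_family_degree_bound[OF assms(1)] assms(1) by blast
qed

section \<open>The vector fields as pairs of polynomials\<close>

text \<open>The indices are shifted as integers, so that the dummy values are read off directly. The
  range always runs up to \<open>k\<close>; for supported sequences the surplus terms
  vanish.\<close>

definition tail_poly :: "nat \<Rightarrow> (int \<Rightarrow> 'a::real_normed_field) \<Rightarrow> nat \<Rightarrow> 'a poly" where
  "tail_poly k a s = (\<Sum>i\<le>k. monom (a (int i + int s)) i)"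

definition supported :: "nat \<Rightarrow> (int \<Rightarrow> 'a::real_normed_field) \<Rightarrow> bool" where
  "supported k a \<longleftrightarrow> (\<forall>r. r \<le> 0 \<or> r > int k \<longrightarrow> a r = 0)"

definition bezoutian_coeff ::
    "(int \<Rightarrow> 'a::real_normed_field) \<Rightarrow> (int \<Rightarrow> 'a) \<Rightarrow> nat \<Rightarrow> nat \<Rightarrow> 'a" where
  "bezoutian_coeff a b s n =
     (\<Sum>r=1..int n. a (int n + int s - r) * b r - b (int n + int s - r) * a r)"

lemma coeff_tail_poly: "supported k a \<Longrightarrow> coeff (tail_poly k a s) n = a (int n + int s)"
  by (auto simp: tail_poly_def coeff_sum supported_def)

lemma degree_tail_poly: "supported k a \<Longrightarrow> degree (tail_poly k a s) \<le> k - s"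
  by (rule degree_le) (auto simp: coeff_tail_poly supported_def)

lemma tail_poly_Suc:
  assumes "supported k a"
  shows "tail_poly k a s = [:a (int s):] + [:0, 1:] * tail_poly k a (Suc s)"
proof (rule poly_eqI)
  fix n
  show "coeff (tail_poly k a s) n = coeff ([:a (int s):] + [:0, 1:] * tail_poly k a (Suc s)) n"
    by (cases n) (simp_all add: coeff_tail_poly[OF assms] ac_simps)
qed

lemma sum_int_nat: "(\<Sum>r=1..int n. f r) = (\<Sum>i=1..n. f (int i))"
  by (rule sum.reindex_bij_witness[of _ int nat]) auto

text \<open>For s >= 1 and supported sequences this is the coefficient of x^(s-1) in the Bezoutian
  (a(x) b(y) - a(y) b(x)) / (x - y), where a(y) is the sum of the a_r y^r.\<close>

definition bezoutian_poly ::
    "nat \<Rightarrow> (int \<Rightarrow> 'a::real_normed_field) \<Rightarrow> (int \<Rightarrow> 'a) \<Rightarrow> nat \<Rightarrow> 'a poly" where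
  "bezoutian_poly k a b s = tail_poly k a s * tail_poly k b 0 - tail_poly k b s * tail_poly k a 0"

lemma bezoutian_coeff_0 [simp]: "bezoutian_coeff a b s 0 = 0"
  by (simp add: bezoutian_coeff_def)

lemma coeff_bezoutian:
  assumes a: "supported k a" and b: "supported k b"
  shows "coeff (bezoutian_poly k a b s) n = bezoutian_coeff a b s n"
proof -
  have *: "coeff (tail_poly k a s * tail_poly k b 0) n = (\<Sum>i=1..n. a (int n + int s - int i) * b (int i))"
    if a: "supported k a" and b: "supported k b" for a b :: "int \<Rightarrow> 'a"
  proof -
    have "coeff (tail_poly k a s * tail_poly k b 0) n = (\<Sum>i\<le>n. b (int i) * a (int (n - i) + int s))"
      by (subst mult.commute) (simp add: coeff_mult coeff_tail_poly[OF a] coeff_tail_poly[OF b])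
    also have "\<dots> = (\<Sum>i\<le>n. a (int n + int s - int i) * b (int i))"
      by (rule sum.cong) (auto simp: of_nat_diff algebra_simps)
    also have "\<dots> = (\<Sum>i=1..n. a (int n + int s - int i) * b (int i))"
      using b by (intro sum.mono_neutral_right) (auto simp: supported_def)
    finally show ?thesis .
  qed
  show ?thesis
    unfolding bezoutian_poly_def coeff_diff *[OF a b] *[OF b a] bezoutian_coeff_def sum_int_nat sum_subtractf ..
qed

text \<open>The reflection r -> m + 1 - r exchanges the two products, so the full sum
  cancels.\<close>

lemma bezoutian_full_sum:
  fixes a b :: "int \<Rightarrow> 'a::real_normed_field"
  shows "(\<Sum>r=1..m. a (m + 1 - r) * b r - b (m + 1 - r) * a r) = 0"
proof -
  have "(\<Sum>r=1..m. b (m + 1 - r) * a r) = (\<Sum>r=1..m. b r * a (m + 1 - r))"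
    by (rule sum.reindex_bij_witness[of _ "\<lambda>r. m + 1 - r" "\<lambda>r. m + 1 - r"]) auto
  then show ?thesis
    by (simp add: sum_subtractf mult.commute)
qed

text \<open>From \<open>n = k\<close> on, the terms with r > n vanish by the support condition, so
  the truncated sum equals the full one. This is the degree drop of the Bezoutian.\<close>

lemma bezoutian_coeff_high:
  assumes a: "supported k a" and b: "supported k b" and "n \<ge> k" "s \<ge> 1"
  shows "bezoutian_coeff a b s n = 0"
proof -
  have "bezoutian_coeff a b s n =
      (\<Sum>r=1..int n + int s - 1. a (int n + int s - r) * b r - b (int n + int s - r) * a r)"
    unfolding bezoutian_coeff_def using assms
    by (intro sum.mono_neutral_left) (auto simp: supported_def)
  also have "\<dots> = 0"
    using bezoutian_full_sum[of a "int n + int s - 1" b] by simp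
  finally show ?thesis .
qed

text \<open>Here the truncation loses exactly one term that can be nonzero, r = k; the value is
  minus that term.\<close>

lemma bezoutian_coeff_top:
  assumes a: "supported k a" and b: "supported k b" and "s \<ge> 2" "k \<ge> 1"
  shows "bezoutian_coeff a b s (k - 1) = b (int s - 1) * a (int k) - a (int s - 1) * b (int k)"
proof -
  let ?f = "\<lambda>r. a (int (k - 1) + int s - r) * b r - b (int (k - 1) + int s - r) * a r"
  have "0 = sum ?f {1..int (k - 1) + int s - 1}"
    using bezoutian_full_sum[of a "int (k - 1) + int s - 1" b] by simp
  also have "\<dots> = sum ?f (insert (int k) {1..int (k - 1)})"
  proof (intro sum.mono_neutral_right ballI)
    fix r assume "r \<in> {1..int (k - 1) + int s - 1} - insert (int k) {1..int (k - 1)}"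
    then have "r > int k" by auto
    then show "?f r = 0" using a b by (simp add: supported_def)
  qed (use assms in auto)
  also have "\<dots> = ?f (int k) + bezoutian_coeff a b s (k - 1)"
    using assms(4) unfolding bezoutian_coeff_def by (subst sum.insert) auto
  also have "?f (int k) = a (int s - 1) * b (int k) - b (int s - 1) * a (int k)"
    using assms(4) by (simp add: of_nat_diff)
  finally show ?thesis by (simp add: algebra_simps eq_neg_iff_add_eq_0 add_eq_0_iff)
qed

definition dUc :: "nat \<Rightarrow> (nat \<Rightarrow> 'a::real_normed_field) \<Rightarrow> int \<Rightarrow> 'a" where
  "dUc k X r = of_int r * Uc (int k) X r"

definition dVc :: "nat \<Rightarrow> (nat \<Rightarrow> 'a::real_normed_field) \<Rightarrow> int \<Rightarrow> 'a" where
  "dVc k X r = of_int r * Vc (int k) X r"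

abbreviation "U_tail k X s \<equiv> tail_poly k (Uc (int k) X) s"
abbreviation "V_tail k X s \<equiv> tail_poly k (Vc (int k) X) s"
abbreviation "dU_tail k X s \<equiv> tail_poly k (dUc k X) s"
abbreviation "dV_tail k X s \<equiv> tail_poly k (dVc k X) s"

abbreviation "W1_rel k X \<equiv> U_tail k X 0 - [:W1c (int k) X:]"
abbreviation "W2_rel k X \<equiv> V_tail k X 0 - [:W2c (int k) X:]"

text \<open>In the notation of the header \<open>U_tail k X j\<close> is \<open>E\<^sub>j\<close> and \<open>V_tail k X j\<close> is \<open>D\<^sub>j\<close>, in particular
  \<open>p = U_tail k X 0\<close> and \<open>q = V_tail k X 0\<close>. As \<open>dUc\<close> carries the factor \<open>r\<close>, the derivatives are
  \<open>p' = dU_tail k X 1\<close> and \<open>q' = dV_tail k X 1\<close>.\<close>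

definition field_poly1 :: "nat \<Rightarrow> (nat \<Rightarrow> 'a::real_normed_field) \<Rightarrow> 'a poly" where
  "field_poly1 k z = [:z (2*k-2):] - (\<Sum>i=1..k-2. monom (z i) i)"

definition field_poly2 :: "nat \<Rightarrow> (nat \<Rightarrow> 'a::real_normed_field) \<Rightarrow> 'a poly" where
  "field_poly2 k z = [:z (2*k-1):] - (\<Sum>i=1..k-1. monom (z (k-2+i)) i)"

lemma coeff_field_poly1:
  "coeff (field_poly1 k z) n = (if n = 0 then z (2*k-2) else if n \<le> k - 2 then - z n else 0)"
  by (cases n) (auto simp: field_poly1_def coeff_sum)

lemma coeff_field_poly2:
  "coeff (field_poly2 k z) n = (if n = 0 then z (2*k-1) else if n \<le> k - 1 then - z (k-2+n) else 0)"
  by (cases n) (auto simp: field_poly2_def coeff_sum)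

lemma target_vec_simps:
  assumes "k \<ge> 2"
  shows "1 \<le> n \<Longrightarrow> n \<le> k - 2 \<Longrightarrow> target_vec k a b c1 c2 n = a n"
    and "1 \<le> n \<Longrightarrow> n \<le> k - 1 \<Longrightarrow> target_vec k a b c1 c2 (k - 2 + n) = b n"
    and "target_vec k a b c1 c2 (2*k-2) = c1" and "target_vec k a b c1 c2 (2*k-1) = c2"
proof -
  show "target_vec k a b c1 c2 (k - 2 + n) = b n" if "1 \<le> n" "n \<le> k - 1"
  proof -
    have "k - 2 + n \<notin> {1..k-2}" "k - 2 + n \<in> {k-1..2*k-3}" "k - 2 + n - (k - 2) = n"
      using that assms by auto
    then show ?thesis by (simp only: target_vec_def if_True if_False)
  qed
  have *: "2*k-2 \<notin> {1..k-2}" "2*k-2 \<notin> {k-1..2*k-3}" "2*k-1 \<notin> {1..k-2}" "2*k-1 \<notin> {k-1..2*k-3}" "2*k-1 \<noteq> 2*k-2"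
    using assms by auto
  show "target_vec k a b c1 c2 (2*k-2) = c1" "target_vec k a b c1 c2 (2*k-1) = c2"
    using * by (simp_all only: target_vec_def if_True if_False simp_thms)
qed (simp add: target_vec_def)

lemma field_poly1_target_eqI:
  assumes "k \<ge> 2" "coeff F 0 = c1" "\<And>n. 1 \<le> n \<Longrightarrow> n \<le> k - 2 \<Longrightarrow> coeff F n = - a n"
    "\<And>n. n \<ge> k - 1 \<Longrightarrow> coeff F n = 0"
  shows "field_poly1 k (target_vec k a b c1 c2) = F"
proof (rule poly_eqI)
  fix n
  consider "n = 0" | "1 \<le> n" "n \<le> k - 2" | "n \<noteq> 0" "n \<ge> k - 1" using assms(1) by linarith
  then show "coeff (field_poly1 k (target_vec k a b c1 c2)) n = coeff F n"
    using assms by cases (auto simp: coeff_field_poly1 target_vec_simps)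
qed

lemma field_poly2_target_eqI:
  assumes "k \<ge> 2" "coeff F 0 = c2" "\<And>n. 1 \<le> n \<Longrightarrow> n \<le> k - 1 \<Longrightarrow> coeff F n = - b n"
    "\<And>n. n \<ge> k \<Longrightarrow> coeff F n = 0"
  shows "field_poly2 k (target_vec k a b c1 c2) = F"
proof (rule poly_eqI)
  fix n
  consider "n = 0" | "1 \<le> n" "n \<le> k - 1" | "n \<noteq> 0" "n \<ge> k" by linarith
  then show "coeff (field_poly2 k (target_vec k a b c1 c2)) n = coeff F n"
  proof cases
    case 1
    then show ?thesis
      using assms(2) by (simp only: coeff_field_poly2 target_vec_simps(4)[OF assms(1)] if_True simp_thms)
  next
    case 2
    then have "n \<noteq> 0" by simp
    with 2 show ?thesis
      by (simp only: coeff_field_poly2 target_vec_simps(2)[OF assms(1)] assms(3) if_True if_False simp_thms)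
  next
    case 3
    then show ?thesis using assms(1,4) by (auto simp: coeff_field_poly2)
  qed
qed

lemma coeff_const: "coeff [:c:] n = (if n = 0 then c else 0)"
  by (cases n) auto

section \<open>The module spanned by the given fields\<close>

text \<open>An inductive closure lets the reductions work with pairs of arbitrary degree. Multiples
  of \<open>W1_rel\<close> enter freely, separately in each component, because this factor is monic
  of degree \<open>k\<close> and a degree count removes them at the end; multiples of
  \<open>W2_rel\<close> are not granted. Rule \<open>cong\<close> compares pairs only on
  \<open>Kn\<close>, where the decomposition of a field is known.\<close>

inductive lift_span ::
    "nat \<Rightarrow> ((nat \<Rightarrow> 'a::real_normed_field) \<Rightarrow> 'a poly) \<Rightarrow> ((nat \<Rightarrow> 'a) \<Rightarrow> 'a poly) \<Rightarrow> bool"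
  for k where
  euler: "lift_span k (\<lambda>X. field_poly1 k (euler_field k X)) (\<lambda>X. field_poly2 k (euler_field k X))"
| family: "i \<in> {1..3} \<Longrightarrow> j \<in> {1..k-1} \<Longrightarrow>
    lift_span k (\<lambda>X. field_poly1 k (family_field k i j X)) (\<lambda>X. field_poly2 k (family_field k i j X))"
| ideal: "poly_family (2*k-1) E1 \<Longrightarrow> poly_family (2*k-1) E2 \<Longrightarrow>
    lift_span k (\<lambda>X. W1_rel k X * E1 X) (\<lambda>X. W1_rel k X * E2 X)"
| add: "lift_span k F1 F2 \<Longrightarrow> lift_span k G1 G2 \<Longrightarrow> lift_span k (\<lambda>X. F1 X + G1 X) (\<lambda>X. F2 X + G2 X)"
| smult: "polynomial_fun (2*k-1) r \<Longrightarrow> lift_span k F1 F2 \<Longrightarrow>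
    lift_span k (\<lambda>X. smult (r X) (F1 X)) (\<lambda>X. smult (r X) (F2 X))"
| cong: "lift_span k F1 F2 \<Longrightarrow> (\<And>X. X \<in> Kn (2*k-1) \<Longrightarrow> F1 X = G1 X) \<Longrightarrow>
    (\<And>X. X \<in> Kn (2*k-1) \<Longrightarrow> F2 X = G2 X) \<Longrightarrow> lift_span k G1 G2"

lemma smult_sum_right: "smult c (sum f A) = (\<Sum>i\<in>A. smult c (f i))"
  by (induction A rule: infinite_finite_induct) (simp_all add: smult_add_right)

text \<open>Turns a derivation in \<open>lift_span\<close> into explicit coefficient functions.
  \<open>E1\<close> and \<open>E2\<close> are arbitrary functions here; comparing degrees will show
  that they vanish.\<close>

lemma lift_span_combination:
  assumes "lift_span k F1 F2"
  shows "\<exists>g_e g E1 E2. polynomial_fun (2*k-1) g_e \<and>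
    (\<forall>i\<in>{1..3}. \<forall>j\<in>{1..k-1}. polynomial_fun (2*k-1) (g i j)) \<and>
    (\<forall>X\<in>Kn (2*k-1).
      F1 X = smult (g_e X) (field_poly1 k (euler_field k X))
        + (\<Sum>i=1..3. \<Sum>j=1..k-1. smult (g i j X) (field_poly1 k (family_field k i j X))) + W1_rel k X * E1 X \<and>
      F2 X = smult (g_e X) (field_poly2 k (euler_field k X))
        + (\<Sum>i=1..3. \<Sum>j=1..k-1. smult (g i j X) (field_poly2 k (family_field k i j X))) + W1_rel k X * E2 X)"
  (is "\<exists>g_e g E1 E2. ?P F1 F2 g_e g E1 E2")
  using assms
proof (induction rule: lift_span.induct)
  case euler
  show ?case
    by (intro exI[of _ "\<lambda>X. 1"] exI[of _ "\<lambda>i j X. 0"] exI[of _ "\<lambda>X. 0"])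
       (auto intro: polynomial_fun.const)
next
  case (family i j)
  have "(\<Sum>i'=1..3. \<Sum>j'=1..k-1. smult (if i' = i \<and> j' = j then 1 else 0) (f (family_field k i' j' X)))
     = f (family_field k i j X)" for f :: "(nat \<Rightarrow> 'a) \<Rightarrow> 'a poly" and X
  proof -
    have "(\<Sum>i'=1..3. \<Sum>j'=1..k-1. smult (if i' = i \<and> j' = j then 1 else 0) (f (family_field k i' j' X)))
      = (\<Sum>i'=1..3. \<Sum>j'=1..k-1. if i' = i then if j' = j then f (family_field k i j X) else 0 else 0)"
      by (intro sum.cong refl) simp
    also have "\<dots> = (\<Sum>i'=1..3. if i' = i then f (family_field k i j X) else 0)"
      by (intro sum.cong refl) (use family in auto)
    finally show ?thesis using family by simp
  qed
  then show ?case
    by (intro exI[of _ "\<lambda>X. 0"] exI[of _ "\<lambda>i' j' X. if i' = i \<and> j' = j then 1 else 0"])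
       (auto intro: polynomial_fun.const)
next
  case (ideal E1 E2)
  show ?case
    by (intro exI[of _ "\<lambda>X. 0"] exI[of _ "\<lambda>i j X. 0"] exI[of _ E1] exI[of _ E2])
       (auto intro: polynomial_fun.const)
next
  case (add F1 F2 G1 G2)
  from add.IH obtain a b E1 E2 a' b' E1' E2' where
    *: "?P F1 F2 a b E1 E2" "?P G1 G2 a' b' E1' E2'" by blast
  have "polynomial_fun (2*k-1) (\<lambda>X. a X + a' X)"
    "\<forall>i\<in>{1..3}. \<forall>j\<in>{1..k-1}. polynomial_fun (2*k-1) (\<lambda>X. b i j X + b' i j X)"
    using * by (auto intro: polynomial_fun.add)
  moreover have "F1 X + G1 X = smult (a X + a' X) (field_poly1 k (euler_field k X))
        + (\<Sum>i=1..3. \<Sum>j=1..k-1. smult (b i j X + b' i j X) (field_poly1 k (family_field k i j X))) + W1_rel k X * (E1 X + E1' X)"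
    "F2 X + G2 X = smult (a X + a' X) (field_poly2 k (euler_field k X))
        + (\<Sum>i=1..3. \<Sum>j=1..k-1. smult (b i j X + b' i j X) (field_poly2 k (family_field k i j X))) + W1_rel k X * (E2 X + E2' X)"
    if "X \<in> Kn (2*k-1)" for X
    using * that by (simp_all only: smult_add_left sum.distrib distrib_left add_ac)
  ultimately have "?P (\<lambda>X. F1 X + G1 X) (\<lambda>X. F2 X + G2 X) (\<lambda>X. a X + a' X) (\<lambda>i j X. b i j X + b' i j X)
     (\<lambda>X. E1 X + E1' X) (\<lambda>X. E2 X + E2' X)"
    by blast
  then show ?case
    by (rule exI[of _ "\<lambda>X. a X + a' X", OF exI[of _ "\<lambda>i j X. b i j X + b' i j X",
        OF exI[of _ "\<lambda>X. E1 X + E1' X", OF exI[of _ "\<lambda>X. E2 X + E2' X"]]]])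
next
  case (smult r F1 F2)
  from smult.IH obtain a b E1 E2 where *: "?P F1 F2 a b E1 E2" by blast
  have "polynomial_fun (2*k-1) (\<lambda>X. r X * a X)"
    "\<forall>i\<in>{1..3}. \<forall>j\<in>{1..k-1}. polynomial_fun (2*k-1) (\<lambda>X. r X * b i j X)"
    using * smult.hyps(1) by (auto intro: polynomial_fun.mult)
  moreover have "smult (r X) (F1 X) = smult (r X * a X) (field_poly1 k (euler_field k X))
        + (\<Sum>i=1..3. \<Sum>j=1..k-1. smult (r X * b i j X) (field_poly1 k (family_field k i j X))) + W1_rel k X * smult (r X) (E1 X)"
    "smult (r X) (F2 X) = smult (r X * a X) (field_poly2 k (euler_field k X))
        + (\<Sum>i=1..3. \<Sum>j=1..k-1. smult (r X * b i j X) (field_poly2 k (family_field k i j X))) + W1_rel k X * smult (r X) (E2 X)"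
    if "X \<in> Kn (2*k-1)" for X
    using * that by (simp_all only: smult_add_right smult_sum_right smult_smult mult_smult_right)
  ultimately have "?P (\<lambda>X. smult (r X) (F1 X)) (\<lambda>X. smult (r X) (F2 X)) (\<lambda>X. r X * a X) (\<lambda>i j X. r X * b i j X)
     (\<lambda>X. smult (r X) (E1 X)) (\<lambda>X. smult (r X) (E2 X))"
    by blast
  then show ?case
    by (rule exI[of _ "\<lambda>X. r X * a X", OF exI[of _ "\<lambda>i j X. r X * b i j X",
        OF exI[of _ "\<lambda>X. smult (r X) (E1 X)", OF exI[of _ "\<lambda>X. smult (r X) (E2 X)"]]]])
next
  case (cong F1 F2 G1 G2)
  from cong.IH obtain a b E1 E2 where "?P F1 F2 a b E1 E2" by blast
  then have "?P G1 G2 a b E1 E2" using cong.hyps(2,3) by simp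
  then show ?case by blast
qed

context
  fixes k :: nat
  assumes k2: "k \<ge> 2"
begin

section \<open>The generators as pairs of polynomials\<close>

lemma supported_Uc: "supported k (Uc (int k) X)" and supported_Vc: "supported k (Vc (int k) X)"
  and supported_dUc: "supported k (dUc k X)" and supported_dVc: "supported k (dVc k X)"
  using k2 by (auto simp: supported_def Uc_def Vc_def dUc_def dVc_def)

lemmas supported_coords = supported_Uc supported_Vc supported_dUc supported_dVc
lemmas coeff_tails = supported_coords[THEN coeff_tail_poly]

lemma coord_simps [simp]: "Uc (int k) X (int k) = 1" "Uc (int k) X (int k - 1) = 0" "Uc (int k) X 0 = 0"
  "dUc k X (int k) = of_nat k" "dUc k X 0 = 0" "Vc (int k) X (int k) = 0" "Vc (int k) X 0 = 0" "dVc k X (int k) = 0" "dVc k X 0 = 0"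
  using k2 by (auto simp: Uc_def Vc_def dUc_def dVc_def)

lemma times_var_dU_tail: "[:0, 1:] * dU_tail k X 1 = dU_tail k X 0" and times_var_dV_tail: "[:0, 1:] * dV_tail k X 1 = dV_tail k X 0"
  using tail_poly_Suc[OF supported_dUc, of X 0] tail_poly_Suc[OF supported_dVc, of X 0] by simp_all

text \<open>In y p' - k p the coefficient of y^r is (r - k) U_r, the weight k - r with the sign of
  the encoding. It vanishes for r = k, and for r = k - 1 by the convention U_(k-1) = 0. The same
  count applies to q.\<close>

lemma euler_polys:
  "field_poly1 k (euler_field k X) = [:0,1:] * dU_tail k X 1 - smult (of_nat k) (W1_rel k X)"
  "field_poly2 k (euler_field k X) = [:0,1:] * dV_tail k X 1 - smult (of_nat k) (W2_rel k X)"
proof -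
  have U0: "dUc k X (int n) = of_nat k * Uc (int k) X (int n)" if "n \<ge> k - 1" for n
    using that k2 by (auto simp: dUc_def Uc_def)
  have V0: "dVc k X (int n) = of_nat k * Vc (int k) X (int n)" if "n \<ge> k" for n
    using that k2 by (auto simp: dVc_def Vc_def)
  show "field_poly1 k (euler_field k X) = [:0,1:] * dU_tail k X 1 - smult (of_nat k) (W1_rel k X)"
    unfolding times_var_dU_tail euler_field_def
    by (rule field_poly1_target_eqI[OF k2]) (use k2 U0 in \<open>auto simp: coeff_tails coeff_const dUc_def algebra_simps\<close>)
  show "field_poly2 k (euler_field k X) = [:0,1:] * dV_tail k X 1 - smult (of_nat k) (W2_rel k X)"
    unfolding times_var_dV_tail euler_field_def
    by (rule field_poly2_target_eqI[OF k2]) (use k2 V0 in \<open>auto simp: coeff_tails coeff_const dVc_def algebra_simps\<close>)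
qed

lemma family_field_simps:
  "family_field k 1 j X = target_vec k (\<lambda>i. A1 (int k) (int i) (int j) X) (\<lambda>i. B1 (int k) (int i) (int j) X)
     (C11 (int k) (int j) X) (C12 (int k) (int j) X)"
  "family_field k 2 j X = target_vec k (\<lambda>i. A2 (int k) (int i) (int j) X) (\<lambda>i. B2 (int k) (int i) (int j) X)
     (C21 (int k) (int j) X) (C22 (int k) (int j) X)"
  "family_field k 3 j X = target_vec k (\<lambda>i. A3 (int k) (int i) (int j) X) (\<lambda>i. B3 (int k) (int i) (int j) X)
     (C31 (int k) (int j) X) (C32 (int k) (int j) X)"
  by (simp_all add: family_field_def Let_def)

text \<open>Apart from the Euler multiple and a y-free multiple of q - W2, the second component is
  -k times E_j (q - W2) - D_j (p - W1). The products of tails form the Bezoutian of p and q, so the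
  degree stays below k; the rest is linear in W1 and W2.\<close>

lemma family1_polys:
  assumes j: "j \<in> {1..k-1}" and u: "u = of_nat (k - j) * Uc (int k) X (int j)"
  shows "field_poly1 k (family_field k 1 j X) = smult u (field_poly1 k (euler_field k X))"
  and "field_poly2 k (family_field k 1 j X) = smult u (field_poly2 k (euler_field k X))
     - smult (of_nat k) (U_tail k X j * W2_rel k X - V_tail k X j * W1_rel k X)
     + smult (of_nat (k - 1) * u + of_nat k * Uc (int k) X (int j)) (W2_rel k X)"
proof -
  have kj: "of_nat (k - j) = (of_nat k - of_nat j :: 'a)"
    "of_nat (k - 1) = (of_nat k - 1 :: 'a)" "j \<le> k"
    using j k2 by (auto simp: of_nat_diff)
  let ?U = "Uc (int k) X" and ?V = "Vc (int k) X"
  show "field_poly1 k (family_field k 1 j X) = smult u (field_poly1 k (euler_field k X))"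
  proof -
    have "dUc k X (int n) = of_nat k * Uc (int k) X (int n)" if "n \<ge> k - 1" for n
      using that k2 by (auto simp: dUc_def Uc_def)
    then show ?thesis
      unfolding family_field_simps euler_polys times_var_dU_tail
      using k2 by (intro field_poly1_target_eqI[OF k2])
         (simp_all add: coeff_tails coeff_const, simp_all add: A1_def C11_def u kj dUc_def algebra_simps)
  qed
  have B: "B1 (int k) (int n) (int j) X = of_nat k * (bezoutian_coeff ?U ?V j n - ?U (int j) * ?V (int n))
     - of_int ((int n-1)*(int k-int j)) * ?U (int j) * ?V (int n)
     + of_nat k * ?V (int n+int j) * W1c (int k) X - of_nat k * ?U (int n+int j) * W2c (int k) X" if "n \<ge> 1" for n
  proof -
    \<comment> \<open>The first sum of \<open>B1\<close> stops at n - 1, one short of the Bezoutian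
      sum; the omitted term r = n is U_j V_n.\<close>
    have "{1..int n} = insert (int n) {1..int n - 1}" using that by auto
    then have "(\<Sum>r=1..int n. ?U (int n + int j - r) * ?V r) = ?U (int j) * ?V (int n) + (\<Sum>r=1..int n - 1. ?U (int n + int j - r) * ?V r)"
      by simp
    then show ?thesis
      unfolding B1_def bezoutian_coeff_def sum_subtractf by (simp add: algebra_simps)
  qed
  \<comment> \<open>All products of two tails are collected in the Bezoutian, whose coefficients
    vanish from degree \<open>k\<close> on.\<close>
  have F: "smult u (field_poly2 k (euler_field k X))
     - smult (of_nat k) (U_tail k X j * W2_rel k X - V_tail k X j * W1_rel k X)
     + smult (of_nat (k - 1) * u + of_nat k * ?U (int j)) (W2_rel k X) =
     smult u (dV_tail k X 0) - smult (of_nat k) (bezoutian_poly k ?U ?V j)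
       + smult (of_nat k * W2c (int k) X) (U_tail k X j) - smult (of_nat k * W1c (int k) X) (V_tail k X j)
     + smult (of_nat k * ?U (int j) - u) (W2_rel k X)"
    unfolding euler_polys times_var_dV_tail kj bezoutian_poly_def
    by (simp add: algebra_simps smult_add_left smult_add_right smult_diff_left smult_diff_right)
  have V0: "?V (int n) = 0" "dVc k X (int n) = 0" "?V (int n + int j) = 0" "?U (int n + int j) = 0" if "n \<ge> k" for n
    using that j k2 by (auto simp: Uc_def Vc_def dVc_def)
  show "field_poly2 k (family_field k 1 j X) = smult u (field_poly2 k (euler_field k X))
     - smult (of_nat k) (U_tail k X j * W2_rel k X - V_tail k X j * W1_rel k X)
     + smult (of_nat (k - 1) * u + of_nat k * ?U (int j)) (W2_rel k X)"
    unfolding F family_field_simps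
    by (intro field_poly2_target_eqI[OF k2])
       (use k2 j V0 in \<open>simp_all add: coeff_tails coeff_const B C12_def u kj dVc_def coeff_bezoutian[OF supported_Uc supported_Vc] bezoutian_coeff_high[OF supported_Uc supported_Vc] algebra_simps\<close>)
qed

text \<open>Splitting off the constant term, A_t = a_t + y A_s, and y B_1 = B_0 turn the first
  product into a_t B_1 + A_s B_0. It serves to multiply a tail by p' or q', which are B_1 for the
  sequences \<open>dUc\<close> and \<open>dVc\<close>.\<close>

lemma tail_poly_bezoutian:
  assumes "supported k a" "supported k b" "s = Suc t"
  shows "tail_poly k a t * tail_poly k b 1 - tail_poly k b s * tail_poly k a 0 =
    smult (a (int t)) (tail_poly k b 1) + bezoutian_poly k a b s"
proof -
  have "tail_poly k b 0 = [:0, 1:] * tail_poly k b 1"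
    using tail_poly_Suc[OF assms(2), of 0] assms(2) by (simp add: supported_def)
  then show ?thesis
    unfolding assms(3) tail_poly_Suc[OF assms(1), of t] bezoutian_poly_def by (simp add: algebra_simps)
qed

lemma lift_coeff:
  assumes "supported k a" "supported k b"
  shows "coeff (smult c (tail_poly k b 1) + smult (of_nat k) (bezoutian_poly k a b s)
      + smult (of_nat k * w) (tail_poly k b s)) n =
      c * b (int n + 1) + of_nat k * bezoutian_coeff a b s n + of_nat k * w * b (int n + int s)"
  by (simp add: coeff_tail_poly[OF assms(2)] coeff_bezoutian[OF assms])

lemma lift_coeff_high:
  assumes "supported k a" "supported k b" "s \<ge> 2" "n \<ge> k"
  shows "c * b (int n + 1) + of_nat k * bezoutian_coeff a b s n + of_nat k * w * b (int n + int s) = 0"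
  using assms bezoutian_coeff_high[OF assms(1,2,4), of s] by (simp add: supported_def)

text \<open>The first component has no room for y^(k-1), since U_(k-1) is not a coordinate.
  Hypothesis \<open>c\<close> says that the multiple of B_1 cancels the top coefficient of the
  Bezoutian; this fixes the y-free part of the multipliers of the fields.\<close>

lemma lift_coeff_top:
  assumes "supported k a" "supported k b" "s \<ge> 2" "n \<ge> k - 1"
    and c: "c * b (int k) = of_nat k * (a (int s - 1) * b (int k) - b (int s - 1) * a (int k))"
  shows "c * b (int n + 1) + of_nat k * bezoutian_coeff a b s n + of_nat k * w * b (int n + int s) = 0"
proof (cases "n = k - 1")
  case True
  then have *: "int n + 1 = int k" "b (int n + int s) = 0"
    using assms(2,3) k2 by (auto simp: supported_def)
  have "bezoutian_coeff a b s n = b (int s - 1) * a (int k) - a (int s - 1) * b (int k)"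
    unfolding True using k2 by (intro bezoutian_coeff_top assms(1-3)) simp
  then show ?thesis
    unfolding * using c by (simp only:) (simp add: algebra_simps)
next
  case False
  then show ?thesis using lift_coeff_high[OF assms(1-3)] assms(4) by simp
qed

text \<open>Multiplying p' by k E_(k-j) and reducing modulo p - W1 would leave a term in y^(k-1);
  subtracting (k - j) U_(k-j) from the multiplier cancels it. Of the constant term k U_(k-j) only j
  U_(k-j) remains, the factor that appears in \<open>A2\<close> and \<open>B2\<close>.\<close>

lemma family2_polys:
  assumes j: "j \<in> {1..k-1}"
    and h: "h = smult (of_nat k) (U_tail k X (k - j)) - [:of_nat (k - j) * Uc (int k) X (int (k - j)):]"
  shows "field_poly1 k (family_field k 2 j X) = h * dU_tail k X 1 - smult (of_nat k) (dU_tail k X (k - j + 1) * W1_rel k X)"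
    and "field_poly2 k (family_field k 2 j X) = h * dV_tail k X 1 - smult (of_nat k) (dV_tail k X (k - j + 1) * W1_rel k X)"
proof -
  let ?U = "Uc (int k) X" and ?V = "Vc (int k) X" and ?W = "W1c (int k) X"
  define s where "s = k - j + 1"
  have s: "s = Suc (k - j)" "s \<ge> 2" "int s = int k - int j + 1" "int (k - j) = int s - 1"
    "of_nat (k - j) = (of_nat k - of_nat j :: 'a)"
    using j k2 by (auto simp: s_def of_nat_diff)
  have main: "h * tail_poly k b 1 - smult (of_nat k) (tail_poly k b (k - j + 1) * W1_rel k X) =
      smult (of_nat j * ?U (int s - 1)) (tail_poly k b 1)
      + smult (of_nat k) (bezoutian_poly k ?U b s)
      + smult (of_nat k * ?W) (tail_poly k b s)" if b: "supported k b" for b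
  proof -
    have "h * tail_poly k b 1 - smult (of_nat k) (tail_poly k b (k - j + 1) * W1_rel k X) =
       smult (of_nat k) (U_tail k X (k - j) * tail_poly k b 1 - tail_poly k b s * U_tail k X 0)
       - smult ((of_nat k - of_nat j) * ?U (int s - 1)) (tail_poly k b 1) + smult (of_nat k * ?W) (tail_poly k b s)"
      unfolding h s_def[symmetric] s(4,5) by (simp add: algebra_simps smult_diff_right smult_add_right)
    also have "\<dots> = smult (of_nat j * ?U (int s - 1)) (tail_poly k b 1)
      + smult (of_nat k) (bezoutian_poly k ?U b s)
      + smult (of_nat k * ?W) (tail_poly k b s)"
      unfolding tail_poly_bezoutian[OF supported_Uc b s(1)] s(4)
      by (simp add: algebra_simps smult_diff_right smult_add_right smult_diff_left smult_add_left)
    finally show ?thesis .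
  qed
  have e: "int n + int s - r = int k + int n - int j - r + 1" "int n + int s = int k + int n - int j + 1"
    "int s - 1 = int k - int j" for n r
    using s(3) by auto
  have os: "(of_nat s :: 'a) = of_nat k - of_nat j + 1"
    using j by (auto simp: s_def of_nat_diff)
  have A: "A2 (int k) (int n) (int j) X = - (of_nat j * ?U (int s - 1) * dUc k X (int n + 1)
     + of_nat k * bezoutian_coeff ?U (dUc k X) s n + of_nat k * ?W * dUc k X (int n + int s))" for n
  proof -
    \<comment> \<open>With b_r = r U_r both products are multiples of U_r U_m, m = n + s - r, and
      the weights combine to r - m.\<close>
    have bez: "bezoutian_coeff ?U (dUc k X) s n =
      - (\<Sum>r=1..int n. of_int (int k+int n-int j-2*r+1) * ?U r * ?U (int k+int n-int j-r+1))"
      unfolding bezoutian_coeff_def sum_negf[symmetric] e dUc_def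
      by (rule sum.cong) (simp_all add: algebra_simps)
    show ?thesis unfolding bez A2_def e dUc_def by (simp add: algebra_simps)
  qed
  have B: "B2 (int k) (int n) (int j) X = - (of_nat j * ?U (int s - 1) * dVc k X (int n + 1)
     + of_nat k * bezoutian_coeff ?U (dVc k X) s n + of_nat k * ?W * dVc k X (int n + int s))" for n
  proof -
    have bez: "bezoutian_coeff ?U (dVc k X) s n =
      - ((\<Sum>r=1..int n. of_int (int k+int n-int j-r+1) * ?U r * ?V (int k+int n-int j-r+1))
         - (\<Sum>r=1..int n. of_int r * ?U (int k+int n-int j-r+1) * ?V r))"
      unfolding bezoutian_coeff_def sum_subtractf[symmetric] sum_negf[symmetric] e dVc_def
      by (rule sum.cong) (simp_all add: algebra_simps)
    show ?thesis unfolding bez B2_def e dVc_def by (simp add: algebra_simps)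
  qed
  show "field_poly1 k (family_field k 2 j X) = h * dU_tail k X 1 - smult (of_nat k) (dU_tail k X (k - j + 1) * W1_rel k X)"
    unfolding family_field_simps main[OF supported_dUc]
    by (rule field_poly1_target_eqI[OF k2]; unfold lift_coeff[OF supported_Uc supported_dUc])
       (simp add: C21_def s(3) os dUc_def algebra_simps, simp add: A,
        rule lift_coeff_top[OF supported_Uc supported_dUc s(2)], simp,
        simp add: dUc_def s(3) algebra_simps)
  show "field_poly2 k (family_field k 2 j X) = h * dV_tail k X 1 - smult (of_nat k) (dV_tail k X (k - j + 1) * W1_rel k X)"
    unfolding family_field_simps main[OF supported_dVc]
    by (rule field_poly2_target_eqI[OF k2]; unfold lift_coeff[OF supported_Uc supported_dVc])
       (simp add: C22_def s(3) os dVc_def algebra_simps, simp add: B,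
        rule lift_coeff_high[OF supported_Uc supported_dVc s(2)])
qed

text \<open>The computation of the second family with V in place of U in the multiplier, and modulo
  q - W2. No constant has to be subtracted: because V_k = 0, the condition of
  \<open>lift_coeff_top\<close> already holds for the full constant term k V_(k-j).\<close>

lemma family3_polys:
  assumes j: "j \<in> {1..k-1}"
    and h: "h = smult (of_nat k) (V_tail k X (k - j))"
  shows "field_poly1 k (family_field k 3 j X) = h * dU_tail k X 1 - smult (of_nat k) (dU_tail k X (k - j + 1) * W2_rel k X)"
    and "field_poly2 k (family_field k 3 j X) = h * dV_tail k X 1 - smult (of_nat k) (dV_tail k X (k - j + 1) * W2_rel k X)"
proof -
  let ?U = "Uc (int k) X" and ?V = "Vc (int k) X" and ?W = "W2c (int k) X"
  define s where "s = k - j + 1"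
  have s: "s = Suc (k - j)" "s \<ge> 2" "int s = int k - int j + 1" "int (k - j) = int s - 1"
    using j k2 by (auto simp: s_def of_nat_diff)
  have main: "h * tail_poly k b 1 - smult (of_nat k) (tail_poly k b (k - j + 1) * W2_rel k X) =
      smult (of_nat k * ?V (int s - 1)) (tail_poly k b 1)
      + smult (of_nat k) (bezoutian_poly k ?V b s)
      + smult (of_nat k * ?W) (tail_poly k b s)" if b: "supported k b" for b
  proof -
    have "h * tail_poly k b 1 - smult (of_nat k) (tail_poly k b (k - j + 1) * W2_rel k X) =
       smult (of_nat k) (V_tail k X (k - j) * tail_poly k b 1 - tail_poly k b s * V_tail k X 0)
       + smult (of_nat k * ?W) (tail_poly k b s)"
      unfolding h s_def[symmetric] by (simp add: algebra_simps smult_diff_right smult_add_right)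
    also have "\<dots> = smult (of_nat k * ?V (int s - 1)) (tail_poly k b 1)
      + smult (of_nat k) (bezoutian_poly k ?V b s)
      + smult (of_nat k * ?W) (tail_poly k b s)"
      unfolding tail_poly_bezoutian[OF supported_Vc b s(1)] s(4)
      by (simp add: algebra_simps smult_diff_right smult_add_right smult_diff_left smult_add_left)
    finally show ?thesis .
  qed
  have e: "int n + int s - r = int k + int n - int j - r + 1" "int n + int s = int k + int n - int j + 1"
    "int s - 1 = int k - int j" for n r
    using s(3) by auto
  have os: "(of_nat s :: 'a) = of_nat k - of_nat j + 1"
    using j by (auto simp: s_def of_nat_diff)
  have A: "A3 (int k) (int n) (int j) X = - (of_nat k * ?V (int s - 1) * dUc k X (int n + 1)
     + of_nat k * bezoutian_coeff ?V (dUc k X) s n + of_nat k * ?W * dUc k X (int n + int s))" for n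
  proof -
    have bez: "bezoutian_coeff ?V (dUc k X) s n =
      - ((\<Sum>r=1..int n. of_int (int k+int n-int j-r+1) * ?U (int k+int n-int j-r+1) * ?V r)
         - (\<Sum>r=1..int n. of_int r * ?U r * ?V (int k+int n-int j-r+1)))"
      unfolding bezoutian_coeff_def sum_subtractf[symmetric] sum_negf[symmetric] e dUc_def
      by (rule sum.cong) (simp_all add: algebra_simps)
    show ?thesis unfolding bez A3_def e dUc_def by (simp add: algebra_simps)
  qed
  have B: "B3 (int k) (int n) (int j) X = - (of_nat k * ?V (int s - 1) * dVc k X (int n + 1)
     + of_nat k * bezoutian_coeff ?V (dVc k X) s n + of_nat k * ?W * dVc k X (int n + int s))" for n
  proof -
    have bez: "bezoutian_coeff ?V (dVc k X) s n =
      - (\<Sum>r=1..int n. of_int (int k+int n-int j-2*r+1) * ?V r * ?V (int k+int n-int j-r+1))"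
      unfolding bezoutian_coeff_def sum_negf[symmetric] e dVc_def
      by (rule sum.cong) (simp_all add: algebra_simps)
    show ?thesis unfolding bez B3_def e dVc_def by (simp add: algebra_simps)
  qed
  show "field_poly1 k (family_field k 3 j X) = h * dU_tail k X 1 - smult (of_nat k) (dU_tail k X (k - j + 1) * W2_rel k X)"
    unfolding family_field_simps main[OF supported_dUc]
    by (rule field_poly1_target_eqI[OF k2]; unfold lift_coeff[OF supported_Vc supported_dUc])
       (simp add: C31_def s(3) os dUc_def algebra_simps, simp add: A,
        rule lift_coeff_top[OF supported_Vc supported_dUc s(2)], simp,
        simp add: dUc_def s(3) algebra_simps)
  show "field_poly2 k (family_field k 3 j X) = h * dV_tail k X 1 - smult (of_nat k) (dV_tail k X (k - j + 1) * W2_rel k X)"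
    unfolding family_field_simps main[OF supported_dVc]
    by (rule field_poly2_target_eqI[OF k2]; unfold lift_coeff[OF supported_Vc supported_dVc])
       (simp add: C32_def s(3) os dVc_def algebra_simps, simp add: B,
        rule lift_coeff_high[OF supported_Vc supported_dVc s(2)])
qed

section \<open>Polynomial dependence on the coordinates, and working modulo the monic
  relation\<close>

lemma polynomial_fun_coords:
  "polynomial_fun (2*k-1) (\<lambda>X :: nat \<Rightarrow> 'a::real_normed_field. Uc (int k) X r)" "polynomial_fun (2*k-1) (\<lambda>X :: nat \<Rightarrow> 'a. Vc (int k) X r)"
  "polynomial_fun (2*k-1) (\<lambda>X :: nat \<Rightarrow> 'a. dUc k X r)" "polynomial_fun (2*k-1) (\<lambda>X :: nat \<Rightarrow> 'a. dVc k X r)"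
  "polynomial_fun (2*k-1) (W1c (int k) :: (nat \<Rightarrow> 'a) \<Rightarrow> 'a)" "polynomial_fun (2*k-1) (W2c (int k) :: (nat \<Rightarrow> 'a) \<Rightarrow> 'a)"
proof -
  have c: "polynomial_fun (2*k-1) (\<lambda>X :: nat \<Rightarrow> 'a. X (nat m))" if "1 \<le> m" "m \<le> 2 * int k - 1" for m
  proof -
    have "nat m \<in> {1..2*k-1}" using that by auto
    then show ?thesis by (rule polynomial_fun.coord)
  qed
  show U: "polynomial_fun (2*k-1) (\<lambda>X :: nat \<Rightarrow> 'a. Uc (int k) X r)"
  proof (cases "1 \<le> r \<and> r \<le> int k - 2")
    case True
    then have "(\<lambda>X :: nat \<Rightarrow> 'a. Uc (int k) X r) = (\<lambda>X :: nat \<Rightarrow> 'a. X (nat r))" by (simp add: Uc_def fun_eq_iff)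
    moreover have "polynomial_fun (2*k-1) (\<lambda>X :: nat \<Rightarrow> 'a. X (nat r))"
      using True k2 by (intro c) auto
    ultimately show ?thesis by (simp only:)
  next
    case False
    then have "(\<lambda>X :: nat \<Rightarrow> 'a. Uc (int k) X r) = (\<lambda>X. if r = int k then 1 else 0)" by (auto simp: Uc_def fun_eq_iff)
    then show ?thesis by (simp only: polynomial_fun.const)
  qed
  show V: "polynomial_fun (2*k-1) (\<lambda>X :: nat \<Rightarrow> 'a. Vc (int k) X r)"
  proof (cases "1 \<le> r \<and> r \<le> int k - 1")
    case True
    then have "(\<lambda>X :: nat \<Rightarrow> 'a. Vc (int k) X r) = (\<lambda>X :: nat \<Rightarrow> 'a. X (nat (int k - 2 + r)))" by (simp add: Vc_def fun_eq_iff)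
    moreover have "polynomial_fun (2*k-1) (\<lambda>X :: nat \<Rightarrow> 'a. X (nat (int k - 2 + r)))"
      using True k2 by (intro c) auto
    ultimately show ?thesis by (simp only:)
  next
    case False
    then have "(\<lambda>X :: nat \<Rightarrow> 'a. Vc (int k) X r) = (\<lambda>X. 0)" by (auto simp: Vc_def fun_eq_iff)
    then show ?thesis by (simp only: polynomial_fun.const)
  qed
  show "polynomial_fun (2*k-1) (\<lambda>X :: nat \<Rightarrow> 'a. dUc k X r)" "polynomial_fun (2*k-1) (\<lambda>X :: nat \<Rightarrow> 'a. dVc k X r)"
    unfolding dUc_def dVc_def by (intro polynomial_fun.mult polynomial_fun.const U V)+
  show "polynomial_fun (2*k-1) (W1c (int k) :: (nat \<Rightarrow> 'a) \<Rightarrow> 'a)" "polynomial_fun (2*k-1) (W2c (int k) :: (nat \<Rightarrow> 'a) \<Rightarrow> 'a)"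
    unfolding W1c_def W2c_def by (rule c; use k2 in linarith)+
qed

lemma poly_family_tail_poly:
  "(\<And>r. polynomial_fun n (\<lambda>X. a X r)) \<Longrightarrow> poly_family n (\<lambda>X. tail_poly k (a X) s)"
  unfolding tail_poly_def by (intro poly_family_sum poly_family_monom)

lemma poly_family_tails:
  "poly_family (2*k-1) (\<lambda>X. U_tail k X s)" "poly_family (2*k-1) (\<lambda>X. V_tail k X s)"
  "poly_family (2*k-1) (\<lambda>X. dU_tail k X s)" "poly_family (2*k-1) (\<lambda>X. dV_tail k X s)"
  "poly_family (2*k-1) (\<lambda>X. [:W1c (int k) X:])" "poly_family (2*k-1) (\<lambda>X. [:W2c (int k) X:])"
  by (rule poly_family_tail_poly poly_family_coeff_const polynomial_fun_coords)+

lemma poly_family_W_rel: "poly_family (2*k-1) (W1_rel k)" "poly_family (2*k-1) (W2_rel k)"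
  by (intro poly_family_diff poly_family_tails)+

lemma lift_span_uminus: "lift_span k F1 F2 \<Longrightarrow> lift_span k (\<lambda>X. - F1 X) (\<lambda>X. - F2 X)"
  using lift_span.smult[OF polynomial_fun.const[of _ "-1"]] by simp

lemma lift_span_diff:
  "lift_span k F1 F2 \<Longrightarrow> lift_span k G1 G2 \<Longrightarrow> lift_span k (\<lambda>X. F1 X - G1 X) (\<lambda>X. F2 X - G2 X)"
  using lift_span.add[OF _ lift_span_uminus] by fastforce

lemma W1_rel_monic: "degree (W1_rel k X) = k" "coeff (W1_rel k X) k = 1"
proof -
  show c: "coeff (W1_rel k X) k = 1"
    using k2 by (simp add: coeff_tails coeff_const)
  have "degree (W1_rel k X) \<le> k"
    by (intro degree_diff_le) (use degree_tail_poly[OF supported_Uc, of X 0] in auto)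
  then show "degree (W1_rel k X) = k"
    using c by (metis le_antisym le_degree zero_neq_one)
qed

lemma divide_W1_rel:
  assumes "poly_family (2*k-1) F"
  obtains R E where "poly_family (2*k-1) R" "poly_family (2*k-1) E"
    "\<And>X. degree (R X) < k \<or> R X = 0" "\<And>X. F X = R X + W1_rel k X * E X"
  using poly_family_divide_monic[OF assms poly_family_W_rel(1) W1_rel_monic] by blast

lemma lift_span_mod:
  assumes "lift_span k F1 F2" "poly_family (2*k-1) E1" "poly_family (2*k-1) E2"
    and "\<And>X. G1 X = F1 X + W1_rel k X * E1 X" "\<And>X. G2 X = F2 X + W1_rel k X * E2 X"
  shows "lift_span k G1 G2"
  using lift_span.add[OF assms(1) lift_span.ideal[OF assms(2,3)]]
  by (rule lift_span.cong) (simp_all add: assms(4,5))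

lemma lift_span_eq:
  assumes "lift_span k F1 F2" "\<And>X. G1 X = F1 X" "\<And>X. G2 X = F2 X"
  shows "lift_span k G1 G2"
  using assms(1) by (rule lift_span.cong) (simp_all add: assms(2,3))

lemma poly_family_0: "poly_family n (\<lambda>X. 0)"
  using poly_family.const[of n 0] by simp

lemma lift_span_0: "lift_span k (\<lambda>X. 0) (\<lambda>X. 0)"
  using lift_span.ideal[OF poly_family_0 poly_family_0] by simp

lemma lift_span_unsmult:
  assumes "lift_span k F1 F2" "c \<noteq> 0" "\<And>X. F1 X = smult c (G1 X)" "\<And>X. F2 X = smult c (G2 X)"
  shows "lift_span k G1 G2"
  using lift_span.smult[OF polynomial_fun.const[of _ "inverse c"] assms(1)]
  by (rule lift_span_eq) (use assms in auto)

section \<open>Reducing multiples of the second relation and the multiplier\<close>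

lemmas smult_distribs = smult_diff_right smult_add_right smult_diff_left smult_add_left

lemma lift_span_W2_rel: "lift_span k (\<lambda>X :: nat \<Rightarrow> 'a::real_normed_field. 0) (W2_rel k)"
proof -
  have 1: "1 \<in> {1..k-1}" using k2 by simp
  \<comment> \<open>In general this tail is y + U_(k-1); the convention U_(k-1) = 0 makes it
    y.\<close>
  have E: "U_tail k X (k - 1) = [:0, 1:]" for X :: "nat \<Rightarrow> 'a"
    by (rule poly_eqI) (use k2 in \<open>auto simp: coeff_tails Uc_def coeff_pCons split: nat.split\<close>)
  have U: "Uc (int k) X (int (k - 1)) = 0" for X :: "nat \<Rightarrow> 'a" using k2 by (simp add: Uc_def)
  have "lift_span k (\<lambda>X :: nat \<Rightarrow> 'a. smult (of_nat k) (field_poly1 k (euler_field k X)) - field_poly1 k (family_field k 2 1 X))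
     (\<lambda>X. smult (of_nat k) (field_poly2 k (euler_field k X)) - field_poly2 k (family_field k 2 1 X))"
    using 1 by (intro lift_span_diff lift_span.smult lift_span.euler lift_span.family polynomial_fun.const) auto
  then have "lift_span k (\<lambda>X :: nat \<Rightarrow> 'a. 0) (\<lambda>X. smult (- (of_nat k ^ 2)) (W2_rel k X))"
  proof (rule lift_span_mod)
    \<comment> \<open>These factors cancel the multiples of \<open>W1_rel\<close> that remain once
      the common multiplier k y has dropped out.\<close>
    show "poly_family (2*k-1) (\<lambda>X. [:of_nat k ^ 2:] - smult (of_nat k) (dU_tail k X (k - 1 + 1)))"
      "poly_family (2*k-1) (\<lambda>X. - smult (of_nat k) (dV_tail k X (k - 1 + 1)))"
      by (intro poly_family_diff poly_family.const poly_family_smult poly_family_uminus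
        poly_family_tails polynomial_fun.const)+
  qed (unfold euler_polys family2_polys[OF 1 refl] E U,
      simp_all add: algebra_simps smult_distribs power2_eq_square)
  then show ?thesis
    by (rule lift_span_unsmult[where c = "- (of_nat k ^ 2)"]) (use k2 in auto)
qed

lemma U_tail_triangular:
  assumes "j < k"
  shows "degree (U_tail k X (k - j)) \<le> j" "coeff (U_tail k X (k - j)) j = 1"
  using degree_tail_poly[OF supported_Uc, of X "k - j"] assms
  by (auto simp: coeff_tails of_nat_diff)

lemma dU_tail_triangular:
  assumes "j < k"
  shows "degree (dU_tail k X (k - j)) \<le> j" "coeff (dU_tail k X (k - j)) j = of_nat k"
  using degree_tail_poly[OF supported_dUc, of X "k - j"] assms
  by (auto simp: coeff_tails of_nat_diff)

lemma U_tail_top: "U_tail k X k = 1"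
  by (rule poly_eqI) (use k2 in \<open>auto simp: coeff_tails Uc_def\<close>)

text \<open>E_k = 1 is covered by \<open>lift_span_W2_rel\<close>, the tails E_1 to E_(k-1) by the
  first family. Being triangular they reach every remainder, and the part divisible by
  \<open>W1_rel\<close> is in the span anyway.\<close>

lemma lift_span_W2_rel_mult:
  fixes F :: "(nat \<Rightarrow> 'a::real_normed_field) \<Rightarrow> 'a poly"
  assumes "poly_family (2*k-1) F"
  shows "lift_span k (\<lambda>X :: nat \<Rightarrow> 'a. 0) (\<lambda>X. W2_rel k X * F X)"
proof -
  have gen: "lift_span k (\<lambda>X :: nat \<Rightarrow> 'a. 0) (\<lambda>X. W2_rel k X * U_tail k X (k - j))" if "j < k" for j
  proof (cases "j = 0")
    case True
    then show ?thesis by (simp add: lift_span_W2_rel U_tail_top)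
  next
    case False
    define i where "i = k - j"
    have i: "i \<in> {1..k-1}" using False that by (auto simp: i_def)
    define u where "u X = of_nat (k - i) * Uc (int k) X (int i)" for X :: "nat \<Rightarrow> 'a"
    define c where "c X = of_nat (k - 1) * u X + of_nat k * Uc (int k) X (int i)" for X :: "nat \<Rightarrow> 'a"
    have u: "polynomial_fun (2*k-1) u"
      unfolding u_def by (intro polynomial_fun.mult polynomial_fun.const polynomial_fun_coords)
    have c: "polynomial_fun (2*k-1) c"
      unfolding c_def by (intro polynomial_fun.add polynomial_fun.mult polynomial_fun.const polynomial_fun_coords u)
    note fam = family1_polys[OF i u_def, folded c_def]
    \<comment> \<open>The summand \<open>smult (c X) 0\<close> is the first component of the
      multiple of (0, \<open>W2_rel\<close>) that is subtracted in the second.\<close>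
    have "lift_span k (\<lambda>X :: nat \<Rightarrow> 'a. field_poly1 k (family_field k 1 i X) - smult (u X) (field_poly1 k (euler_field k X)) - smult (c X) 0)
     (\<lambda>X. field_poly2 k (family_field k 1 i X) - smult (u X) (field_poly2 k (euler_field k X)) - smult (c X) (W2_rel k X))"
      using i by (intro lift_span_diff lift_span.smult lift_span.euler lift_span.family lift_span_W2_rel u c) auto
    then have "lift_span k (\<lambda>X :: nat \<Rightarrow> 'a. 0) (\<lambda>X. smult (- of_nat k) (W2_rel k X * U_tail k X i))"
      by (rule lift_span_mod[where ?E1.0 = "\<lambda>X. 0" and ?E2.0 = "\<lambda>X. - smult (of_nat k) (V_tail k X i)"])
         (rule poly_family_0, intro poly_family_smult poly_family_uminus poly_family_tails polynomial_fun.const,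
          unfold fam, simp_all add: algebra_simps smult_distribs)
    then show ?thesis
      unfolding i_def by (rule lift_span_unsmult[where c = "- of_nat k"]) (use k2 in auto)
  qed
  obtain R E where RE: "poly_family (2*k-1) R" "poly_family (2*k-1) E"
    "\<And>X. degree (R X) < k \<or> R X = 0" "\<And>X. F X = R X + W1_rel k X * E X"
    using divide_W1_rel[OF assms] by blast
  have "lift_span k (\<lambda>X :: nat \<Rightarrow> 'a. 0) (\<lambda>X. W2_rel k X * R X)"
  proof (rule triangular_closure[OF RE(1,3), where c = "\<lambda>_. 1" and t = "\<lambda>j X. U_tail k X (k - j)"])
    show "poly_family (2*k-1) (\<lambda>X. U_tail k X (k - j))" for j by (rule poly_family_tails)
    show "lift_span k (\<lambda>X :: nat \<Rightarrow> 'a. 0) (\<lambda>X. W2_rel k X * (F X + G X))"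
      if "lift_span k (\<lambda>X :: nat \<Rightarrow> 'a. 0) (\<lambda>X. W2_rel k X * F X)" "lift_span k (\<lambda>X :: nat \<Rightarrow> 'a. 0) (\<lambda>X. W2_rel k X * G X)" for F G
      using lift_span.add[OF that] by (simp add: distrib_left)
    show "lift_span k (\<lambda>X :: nat \<Rightarrow> 'a. 0) (\<lambda>X. W2_rel k X * smult (f X) (F X))"
      if "polynomial_fun (2*k-1) f" "lift_span k (\<lambda>X :: nat \<Rightarrow> 'a. 0) (\<lambda>X. W2_rel k X * F X)" for f F
      using lift_span.smult[OF that] by simp
  qed (auto simp: gen U_tail_triangular lift_span_0)
  then show ?thesis
    by (rule lift_span_mod[where ?E1.0 = "\<lambda>X. 0" and ?E2.0 = "\<lambda>X. W2_rel k X * E X"])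
       (rule poly_family_0, rule poly_family.mult[OF poly_family_W_rel(2) RE(2)], simp_all add: RE(4) distrib_left mult.left_commute)
qed

text \<open>The third family reaches only the \<open>g\<close> of degree at most \<open>k - 2\<close>. The coefficient of
  \<open>y\<^sup>k\<^sup>-\<^sup>1\<close> is removed by subtracting a multiple \<open>c p'\<close> from \<open>g\<close>, which adds
  \<open>c (q - W\<^sub>2)\<close> to the multiplier \<open>h\<close>.\<close>

lemma lift_span_reduce_W2_rel:
  fixes g :: "(nat \<Rightarrow> 'a::real_normed_field) \<Rightarrow> 'a poly"
  assumes "poly_family (2*k-1) g"
  shows "\<exists>h. poly_family (2*k-1) h \<and> lift_span k (\<lambda>X :: nat \<Rightarrow> 'a. W2_rel k X * g X + h X * dU_tail k X 1) (\<lambda>X. h X * dV_tail k X 1)"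
proof -
  define Q where "Q g \<longleftrightarrow> (\<exists>h. poly_family (2*k-1) h \<and>
    lift_span k (\<lambda>X :: nat \<Rightarrow> 'a. W2_rel k X * g X + h X * dU_tail k X 1) (\<lambda>X. h X * dV_tail k X 1))" for g :: "(nat \<Rightarrow> 'a) \<Rightarrow> 'a poly"
  have gen: "Q (\<lambda>X. dU_tail k X (k - j))" if "j < k - 1" for j
  proof -
    \<comment> \<open>The sign and the shift come from dividing member j + 1 of the third family by
      -k.\<close>
    define h where "h X = - V_tail k X (k - Suc j)" for X :: "nat \<Rightarrow> 'a"
    have h: "poly_family (2*k-1) h" unfolding h_def by (intro poly_family_uminus poly_family_tails)
    have j: "Suc j \<in> {1..k-1}" "k - Suc j + 1 = k - j" using that by auto
    note fam = family3_polys[OF j(1) refl, unfolded j(2)]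
    \<comment> \<open>The third family has a multiple of \<open>W2_rel\<close> in its second
      component too; the added term clears it.\<close>
    have "lift_span k (\<lambda>X :: nat \<Rightarrow> 'a. field_poly1 k (family_field k 3 (Suc j) X) + 0)
      (\<lambda>X. field_poly2 k (family_field k 3 (Suc j) X) + W2_rel k X * smult (of_nat k) (dV_tail k X (k - j)))"
      using j by (intro lift_span.add lift_span.family lift_span_W2_rel_mult poly_family_smult poly_family_tails polynomial_fun.const) auto
    then have "lift_span k (\<lambda>X :: nat \<Rightarrow> 'a. W2_rel k X * dU_tail k X (k - j) + h X * dU_tail k X 1) (\<lambda>X. h X * dV_tail k X 1)"
      by (rule lift_span_unsmult[where c = "- of_nat k"])
         (use k2 in \<open>unfold fam h_def, simp_all add: algebra_simps smult_distribs\<close>)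
    then show ?thesis using h unfolding Q_def by blast
  qed
  have low: "Q L" if L: "poly_family (2*k-1) L" "\<And>X. degree (L X) < k - 1 \<or> L X = 0" for L
  proof (rule triangular_closure[OF L, where c = "\<lambda>_. of_nat k" and t = "\<lambda>j X. dU_tail k X (k - j)"])
    show "poly_family (2*k-1) (\<lambda>X. dU_tail k X (k - j))" for j by (rule poly_family_tails)
    show "Q (\<lambda>X. 0)" unfolding Q_def
      by (rule exI[of _ "\<lambda>X. 0"]) (simp add: lift_span_0 poly_family_0)
    show "Q (\<lambda>X. F X + G X)" if "Q F" "Q G" for F G
    proof -
      obtain h h' where *: "poly_family (2*k-1) h" "poly_family (2*k-1) h'"
        "lift_span k (\<lambda>X :: nat \<Rightarrow> 'a. W2_rel k X * F X + h X * dU_tail k X 1) (\<lambda>X. h X * dV_tail k X 1)"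
        "lift_span k (\<lambda>X :: nat \<Rightarrow> 'a. W2_rel k X * G X + h' X * dU_tail k X 1) (\<lambda>X. h' X * dV_tail k X 1)"
        using \<open>Q F\<close> \<open>Q G\<close> unfolding Q_def by blast
      have "lift_span k (\<lambda>X. W2_rel k X * (F X + G X) + (h X + h' X) * dU_tail k X 1) (\<lambda>X. (h X + h' X) * dV_tail k X 1)"
        using lift_span.add[OF *(3,4)] by (rule lift_span_eq) (simp_all add: algebra_simps smult_distribs)
      then show ?thesis
        unfolding Q_def using poly_family.add[OF *(1,2)] by blast
    qed
    show "Q (\<lambda>X. smult (f X) (F X))" if f: "polynomial_fun (2*k-1) f" and "Q F" for f F
    proof -
      obtain h where *: "poly_family (2*k-1) h"
        "lift_span k (\<lambda>X :: nat \<Rightarrow> 'a. W2_rel k X * F X + h X * dU_tail k X 1) (\<lambda>X. h X * dV_tail k X 1)"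
        using \<open>Q F\<close> unfolding Q_def by blast
      show ?thesis
        unfolding Q_def using poly_family_smult[OF f *(1)] lift_span.smult[OF f *(2)]
        by (intro exI[of _ "\<lambda>X. smult (f X) (h X)"]) (simp add: smult_add_right)
    qed
  qed (use k2 in \<open>auto simp: gen dU_tail_triangular\<close>)
  obtain R E where RE: "poly_family (2*k-1) R" "poly_family (2*k-1) E"
    "\<And>X. degree (R X) < k \<or> R X = 0" "\<And>X. g X = R X + W1_rel k X * E X"
    using divide_W1_rel[OF assms] by blast
  define c where "c X = inverse (of_nat k) * coeff (R X) (k - 1)" for X
  have c: "polynomial_fun (2*k-1) c"
    unfolding c_def by (intro polynomial_fun.mult polynomial_fun.const polynomial_fun_coeff RE)
  define L where "L X = R X - smult (c X) (dU_tail k X 1)" for X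
  have "poly_family (2*k-1) L"
    unfolding L_def by (intro poly_family_diff poly_family_smult RE c poly_family_tails)
  moreover have "degree (L X) < k - 1 \<or> L X = 0" for X
  proof (rule degree_less_or_zero)
    show "degree (L X) \<le> k - 1"
      unfolding L_def using RE(3)[of X] dU_tail_triangular(1)[of "k - 1" X] k2
      by (intro degree_diff_le) (auto intro: order.trans[OF degree_smult_le])
    show "coeff (L X) (k - 1) = 0"
      unfolding L_def c_def using dU_tail_triangular(2)[of "k - 1" X] k2 by simp
  qed
  ultimately have "Q L" by (rule low)
  then obtain h where h: "poly_family (2*k-1) h"
    "lift_span k (\<lambda>X :: nat \<Rightarrow> 'a. W2_rel k X * L X + h X * dU_tail k X 1) (\<lambda>X. h X * dV_tail k X 1)"
    unfolding Q_def by blast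
  \<comment> \<open>Both components must keep a common multiplier: trading c p' for a change of
    \<open>h\<close> in the first requires subtracting c q' times \<open>W2_rel\<close> in the
    second, which the span allows.\<close>
  have "lift_span k (\<lambda>X :: nat \<Rightarrow> 'a. (W2_rel k X * L X + h X * dU_tail k X 1) - 0)
      (\<lambda>X. h X * dV_tail k X 1 - W2_rel k X * smult (c X) (dV_tail k X 1))"
    by (intro lift_span_diff h lift_span_W2_rel_mult poly_family_smult c poly_family_tails)
  then have "lift_span k (\<lambda>X :: nat \<Rightarrow> 'a. W2_rel k X * g X + (h X - smult (c X) (W2_rel k X)) * dU_tail k X 1)
      (\<lambda>X. (h X - smult (c X) (W2_rel k X)) * dV_tail k X 1)"
    by (rule lift_span_mod[where ?E1.0 = "\<lambda>X. W2_rel k X * E X" and ?E2.0 = "\<lambda>X. 0"])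
       (rule poly_family.mult[OF poly_family_W_rel(2) RE(2)], rule poly_family_0,
        simp_all add: RE(4) L_def algebra_simps smult_distribs)
  then show ?thesis
    by (intro exI[of _ "\<lambda>X. h X - smult (c X) (W2_rel k X)"] conjI poly_family_diff h(1)
        poly_family_smult c poly_family_W_rel)
qed

text \<open>Up to the factor k, the multipliers of the second family are E_(k-j) minus a y-free
  term. Together with E_k = 1 these tails are triangular, so every remainder differs from some
  y-free \<open>r\<close> by a multiplier realised in the span.\<close>

lemma lift_span_reduce_multiplier:
  fixes h :: "(nat \<Rightarrow> 'a::real_normed_field) \<Rightarrow> 'a poly"
  assumes "poly_family (2*k-1) h"
  shows "\<exists>r. polynomial_fun (2*k-1) r \<and>
    lift_span k (\<lambda>X :: nat \<Rightarrow> 'a. (h X - [:r X:]) * dU_tail k X 1) (\<lambda>X. (h X - [:r X:]) * dV_tail k X 1)"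
proof -
  define Q where "Q h \<longleftrightarrow> (\<exists>r. polynomial_fun (2*k-1) r \<and>
    lift_span k (\<lambda>X :: nat \<Rightarrow> 'a. (h X - [:r X:]) * dU_tail k X 1) (\<lambda>X. (h X - [:r X:]) * dV_tail k X 1))"
    for h :: "(nat \<Rightarrow> 'a) \<Rightarrow> 'a poly"
  have gen: "Q (\<lambda>X. U_tail k X (k - j))" if "j < k" for j
  proof (cases "j = 0")
    case True
    \<comment> \<open>E_k = 1 is itself free of y: with r = 1 the zero pair is left.\<close>
    then show ?thesis unfolding Q_def
      by (intro exI[of _ "\<lambda>X. 1"]) (simp add: lift_span_0 True U_tail_top polynomial_fun.const flip: one_pCons)
  next
    case False
    then have j: "j \<in> {1..k-1}" using that by auto
    \<comment> \<open>The y-free term in the multiplier of the second family, divided by k.\<close>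
    define r where "r X = inverse (of_nat k) * (of_nat (k - j) * Uc (int k) X (int (k - j)))" for X :: "nat \<Rightarrow> 'a"
    have r: "polynomial_fun (2*k-1) r"
      unfolding r_def by (intro polynomial_fun.mult polynomial_fun.const polynomial_fun_coords)
    have H: "smult (of_nat k) (U_tail k X (k - j)) - [:of_nat (k - j) * Uc (int k) X (int (k - j)):]
        = smult (of_nat k) (U_tail k X (k - j) - [:r X:])" for X :: "nat \<Rightarrow> 'a"
      using k2 by (simp add: r_def smult_diff_right)
    note fam = family2_polys[OF j refl, of X for X :: "nat \<Rightarrow> 'a", unfolded H]
    have "lift_span k (\<lambda>X :: nat \<Rightarrow> 'a. field_poly1 k (family_field k 2 j X)) (\<lambda>X. field_poly2 k (family_field k 2 j X))"
      using j by (intro lift_span.family) auto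
    then have "lift_span k (\<lambda>X :: nat \<Rightarrow> 'a. smult (of_nat k) ((U_tail k X (k - j) - [:r X:]) * dU_tail k X 1))
      (\<lambda>X. smult (of_nat k) ((U_tail k X (k - j) - [:r X:]) * dV_tail k X 1))"
      by (rule lift_span_mod[where ?E1.0 = "\<lambda>X. smult (of_nat k) (dU_tail k X (k - j + 1))"
            and ?E2.0 = "\<lambda>X. smult (of_nat k) (dV_tail k X (k - j + 1))"])
         (intro poly_family_smult polynomial_fun.const poly_family_tails, intro poly_family_smult polynomial_fun.const poly_family_tails,
           simp_all add: fam mult.commute)
    then have "lift_span k (\<lambda>X :: nat \<Rightarrow> 'a. (U_tail k X (k - j) - [:r X:]) * dU_tail k X 1)
      (\<lambda>X. (U_tail k X (k - j) - [:r X:]) * dV_tail k X 1)"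
      by (rule lift_span_unsmult) (use k2 in auto)
    then show ?thesis using r unfolding Q_def by blast
  qed
  obtain R E where RE: "poly_family (2*k-1) R" "poly_family (2*k-1) E"
    "\<And>X. degree (R X) < k \<or> R X = 0" "\<And>X. h X = R X + W1_rel k X * E X"
    using divide_W1_rel[OF assms] by blast
  have "Q R"
  proof (rule triangular_closure[OF RE(1,3), where c = "\<lambda>_. 1" and t = "\<lambda>j X. U_tail k X (k - j)"])
    show "poly_family (2*k-1) (\<lambda>X. U_tail k X (k - j))" for j by (rule poly_family_tails)
    show "Q (\<lambda>X. 0)" unfolding Q_def
      by (rule exI[of _ "\<lambda>X. 0"]) (simp add: lift_span_0 polynomial_fun.const)
    show "Q (\<lambda>X. F X + G X)" if "Q F" "Q G" for F G
    proof -
      obtain r r' where *: "polynomial_fun (2*k-1) r" "polynomial_fun (2*k-1) r'"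
        "lift_span k (\<lambda>X :: nat \<Rightarrow> 'a. (F X - [:r X:]) * dU_tail k X 1) (\<lambda>X. (F X - [:r X:]) * dV_tail k X 1)"
        "lift_span k (\<lambda>X :: nat \<Rightarrow> 'a. (G X - [:r' X:]) * dU_tail k X 1) (\<lambda>X. (G X - [:r' X:]) * dV_tail k X 1)"
        using \<open>Q F\<close> \<open>Q G\<close> unfolding Q_def by blast
      have "lift_span k (\<lambda>X :: nat \<Rightarrow> 'a. (F X + G X - [:r X + r' X:]) * dU_tail k X 1) (\<lambda>X. (F X + G X - [:r X + r' X:]) * dV_tail k X 1)"
        using lift_span.add[OF *(3,4)] by (rule lift_span_eq) (simp_all add: algebra_simps smult_distribs)
      then show ?thesis
        unfolding Q_def using polynomial_fun.add[OF *(1,2)] by blast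
    qed
    show "Q (\<lambda>X. smult (f X) (F X))" if f: "polynomial_fun (2*k-1) f" and "Q F" for f F
    proof -
      obtain r where *: "polynomial_fun (2*k-1) r"
        "lift_span k (\<lambda>X :: nat \<Rightarrow> 'a. (F X - [:r X:]) * dU_tail k X 1) (\<lambda>X. (F X - [:r X:]) * dV_tail k X 1)"
        using \<open>Q F\<close> unfolding Q_def by blast
      have "lift_span k (\<lambda>X :: nat \<Rightarrow> 'a. (smult (f X) (F X) - [:f X * r X:]) * dU_tail k X 1)
          (\<lambda>X. (smult (f X) (F X) - [:f X * r X:]) * dV_tail k X 1)"
        using lift_span.smult[OF f *(2)] by (rule lift_span_eq) (simp_all add: algebra_simps smult_distribs)
      then show ?thesis
        unfolding Q_def using polynomial_fun.mult[OF f *(1)] by blast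
    qed
  qed (auto simp: gen U_tail_triangular)
  then obtain r where r: "polynomial_fun (2*k-1) r"
    "lift_span k (\<lambda>X :: nat \<Rightarrow> 'a. (R X - [:r X:]) * dU_tail k X 1) (\<lambda>X. (R X - [:r X:]) * dV_tail k X 1)"
    unfolding Q_def by blast
  from r(2) have "lift_span k (\<lambda>X :: nat \<Rightarrow> 'a. (h X - [:r X:]) * dU_tail k X 1) (\<lambda>X. (h X - [:r X:]) * dV_tail k X 1)"
    by (rule lift_span_mod[where ?E1.0 = "\<lambda>X. E X * dU_tail k X 1" and ?E2.0 = "\<lambda>X. E X * dV_tail k X 1"])
       (intro poly_family.mult RE poly_family_tails, intro poly_family.mult RE poly_family_tails, simp_all add: RE(4) algebra_simps)
  then show ?thesis using r(1) by blast
qed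

section \<open>Comparing degrees\<close>

lemma multiple_of_W1_rel_eq_0:
  assumes "degree (W1_rel k X * E) < k"
  shows "E = 0"
proof (rule ccontr)
  assume "E \<noteq> 0"
  moreover have "W1_rel k X \<noteq> 0" using W1_rel_monic(2)[of X] by force
  ultimately show False
    using degree_mult_eq[of "W1_rel k X" E] W1_rel_monic(1)[of X] assms by simp
qed

lemma degree_field_poly: "degree (field_poly1 k z) \<le> k - 2" "degree (field_poly2 k z) \<le> k - 1"
  by (auto intro!: degree_le simp: coeff_field_poly1 coeff_field_poly2)

text \<open>The whole decomposition lies in the span except for a y-free multiple r of (p', q').
  Degrees are compared for each fixed \<open>X\<close>: all other terms have degree below k, so the
  multiples of \<open>W1_rel\<close> vanish, and only then can r be read off in degree k - 1 of the
  first components.\<close>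

lemma decomposition_imp_generated:
  assumes "poly_family (2*k-1) h" "poly_family (2*k-1) e1" "poly_family (2*k-1) e2"
    "poly_family (2*k-1) g1" "poly_family (2*k-1) g2"
    and 1: "\<And>X. X \<in> Kn (2*k-1) \<Longrightarrow> field_poly1 k (\<xi> X) = h X * dU_tail k X 1 + W1_rel k X * e1 X + W2_rel k X * g1 X"
    and 2: "\<And>X. X \<in> Kn (2*k-1) \<Longrightarrow> field_poly2 k (\<xi> X) = h X * dV_tail k X 1 + W1_rel k X * e2 X + W2_rel k X * g2 X"
  shows "\<exists>g_e g. polynomial_fun (2*k-1) g_e \<and>
           (\<forall>i\<in>{1..3}. \<forall>j\<in>{1..k-1}. polynomial_fun (2*k-1) (g i j)) \<and>
           (\<forall>X\<in>Kn (2*k-1). \<forall>m\<in>{1..2*k-1}.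
              \<xi> X m = g_e X * euler_field k X m +
                (\<Sum>i=1..3. \<Sum>j=1..k-1. g i j X * family_field k i j X m))"
proof -
  obtain h1 where h1: "poly_family (2*k-1) h1"
    "lift_span k (\<lambda>X. W2_rel k X * g1 X + h1 X * dU_tail k X 1) (\<lambda>X. h1 X * dV_tail k X 1)"
    using lift_span_reduce_W2_rel[OF assms(4)] by blast
  obtain r where r: "polynomial_fun (2*k-1) r"
    "lift_span k (\<lambda>X. (h X - h1 X - [:r X:]) * dU_tail k X 1) (\<lambda>X. (h X - h1 X - [:r X:]) * dV_tail k X 1)"
    using lift_span_reduce_multiplier[OF poly_family_diff[OF assms(1) h1(1)]] by blast
  have "lift_span k (\<lambda>X. (W2_rel k X * g1 X + h1 X * dU_tail k X 1) + (h X - h1 X - [:r X:]) * dU_tail k X 1 + 0 + W1_rel k X * e1 X)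
     (\<lambda>X. h1 X * dV_tail k X 1 + (h X - h1 X - [:r X:]) * dV_tail k X 1 + W2_rel k X * g2 X + W1_rel k X * e2 X)"
    by (intro lift_span.add h1(2) r(2) lift_span_W2_rel_mult lift_span.ideal assms)
  then have "lift_span k (\<lambda>X. field_poly1 k (\<xi> X) - smult (r X) (dU_tail k X 1)) (\<lambda>X. field_poly2 k (\<xi> X) - smult (r X) (dV_tail k X 1))"
    by (rule lift_span.cong) (simp_all add: 1 2 algebra_simps)
  from lift_span_combination[OF this] obtain g_e g E1 E2 where g: "polynomial_fun (2*k-1) g_e"
    "\<forall>i\<in>{1..3}. \<forall>j\<in>{1..k-1}. polynomial_fun (2*k-1) (g i j)"
    and g1: "\<And>X. X \<in> Kn (2*k-1) \<Longrightarrow> field_poly1 k (\<xi> X) - smult (r X) (dU_tail k X 1) =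
      smult (g_e X) (field_poly1 k (euler_field k X))
        + (\<Sum>i=1..3. \<Sum>j=1..k-1. smult (g i j X) (field_poly1 k (family_field k i j X))) + W1_rel k X * E1 X"
    and g2: "\<And>X. X \<in> Kn (2*k-1) \<Longrightarrow> field_poly2 k (\<xi> X) - smult (r X) (dV_tail k X 1) =
      smult (g_e X) (field_poly2 k (euler_field k X))
        + (\<Sum>i=1..3. \<Sum>j=1..k-1. smult (g i j X) (field_poly2 k (family_field k i j X))) + W1_rel k X * E2 X"
    by blast
  have "\<xi> X m = g_e X * euler_field k X m + (\<Sum>i=1..3. \<Sum>j=1..k-1. g i j X * family_field k i j X m)"
    if X: "X \<in> Kn (2*k-1)" and m: "m \<in> {1..2*k-1}" for X m
  proof -
    let ?c1 = "smult (g_e X) (field_poly1 k (euler_field k X))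
        + (\<Sum>i=1..3. \<Sum>j=1..k-1. smult (g i j X) (field_poly1 k (family_field k i j X)))"
    let ?c2 = "smult (g_e X) (field_poly2 k (euler_field k X))
        + (\<Sum>i=1..3. \<Sum>j=1..k-1. smult (g i j X) (field_poly2 k (family_field k i j X)))"
    have sm: "degree (smult c p) \<le> n" if "degree p \<le> n" for c :: 'a and p n
      using that degree_smult_le order.trans by blast
    have d1: "degree ?c1 \<le> k - 2"
      by (intro degree_add_le degree_sum_le sm degree_field_poly) auto
    have d2: "degree ?c2 \<le> k - 1"
      by (intro degree_add_le degree_sum_le sm degree_field_poly) auto
    have p: "degree (dU_tail k X 1) \<le> k - 1" "degree (dV_tail k X 1) \<le> k - 1"
      using degree_tail_poly supported_coords by blast+
    have e1: "E1 X = 0"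
    proof (rule multiple_of_W1_rel_eq_0)
      have "W1_rel k X * E1 X = field_poly1 k (\<xi> X) - smult (r X) (dU_tail k X 1) - ?c1"
        using g1[OF X] by (simp add: algebra_simps)
      moreover have "degree (field_poly1 k (\<xi> X) - smult (r X) (dU_tail k X 1) - ?c1) \<le> k - 1"
        using d1 degree_field_poly(1)[of "\<xi> X"] by (intro degree_diff_le sm p) auto
      ultimately show "degree (W1_rel k X * E1 X) < k" using k2 by simp
    qed
    have e2: "E2 X = 0"
    proof (rule multiple_of_W1_rel_eq_0)
      have "W1_rel k X * E2 X = field_poly2 k (\<xi> X) - smult (r X) (dV_tail k X 1) - ?c2"
        using g2[OF X] by (simp add: algebra_simps)
      moreover have "degree (field_poly2 k (\<xi> X) - smult (r X) (dV_tail k X 1) - ?c2) \<le> k - 1"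
        using d2 degree_field_poly(2)[of "\<xi> X"] by (intro degree_diff_le sm p) auto
      ultimately show "degree (W1_rel k X * E2 X) < k" using k2 by simp
    qed
    have r0: "r X = 0"
    proof -
      have "coeff ?c1 (k - 1) = 0"
        by (rule coeff_eq_0) (use d1 k2 in linarith)
      moreover have "coeff (field_poly1 k (\<xi> X)) (k - 1) = 0"
        by (rule coeff_eq_0) (use degree_field_poly(1)[of "\<xi> X"] k2 in linarith)
      ultimately have "coeff (smult (r X) (dU_tail k X 1)) (k - 1) = 0"
        using arg_cong[OF g1[OF X], of "\<lambda>p. coeff p (k - 1)"] e1
        by (simp only: coeff_diff mult_zero_right add_0_right diff_0 neg_equal_0_iff_equal)
      then show ?thesis
        using dU_tail_triangular(2)[of "k - 1" X] k2 by simp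
    qed
    have c1: "coeff (field_poly1 k (\<xi> X)) n = coeff ?c1 n" and c2: "coeff (field_poly2 k (\<xi> X)) n = coeff ?c2 n" for n
      using g1[OF X] g2[OF X] e1 e2 r0 by simp_all
    consider "m \<noteq> 0" "m \<le> k - 2" | n where "m = k - 2 + n" "n \<noteq> 0" "n \<le> k - 1" | "m = 2*k-2" | "m = 2*k-1"
    proof -
      assume a: "\<And>n. m = k - 2 + n \<Longrightarrow> n \<noteq> 0 \<Longrightarrow> n \<le> k - 1 \<Longrightarrow> thesis" "m \<noteq> 0 \<Longrightarrow> m \<le> k - 2 \<Longrightarrow> thesis"
        "m = 2*k-2 \<Longrightarrow> thesis" "m = 2*k-1 \<Longrightarrow> thesis"
      show thesis
        using a(1)[of "m - (k - 2)"] a(2-4) m k2 by fastforce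
    qed
    then show ?thesis
    proof cases
      case 1
      then have "- \<xi> X m = - (g_e X * euler_field k X m + (\<Sum>i=1..3. \<Sum>j=1..k-1. g i j X * family_field k i j X m))"
        using c1[of m] by (simp add: coeff_field_poly1 coeff_sum sum_negf)
      then show ?thesis by (simp only: neg_equal_iff_equal)
    next
      case 2
      then have "- \<xi> X m = - (g_e X * euler_field k X m + (\<Sum>i=1..3. \<Sum>j=1..k-1. g i j X * family_field k i j X m))"
        using c2[of n] by (simp add: coeff_field_poly2 coeff_sum sum_negf)
      then show ?thesis by (simp only: neg_equal_iff_equal)
    next
      case 3
      then show ?thesis using c1[of 0] by (simp add: coeff_field_poly1 coeff_sum)
    next
      case 4
      then show ?thesis using c2[of 0] by (simp add: coeff_field_poly2 coeff_sum)
    qed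
  qed
  then show ?thesis using g by blast
qed

section \<open>Liftable fields\<close>

lemma has_field_derivative_fun_upd:
  "((\<lambda>t. (x(j := t)) i) has_field_derivative (if i = j then 1 else 0)) (at t)"
  by (cases "i = j") auto

lemma sum_delta_mult:
  "finite A \<Longrightarrow> a \<in> A \<Longrightarrow> (\<Sum>j\<in>A. (if a = j then c else 0) * f j) = (c * f a :: 'a::comm_ring_1)"
proof -
  assume A: "finite A" "a \<in> A"
  have "(\<Sum>j\<in>A. (if a = j then c else 0) * f j) = (\<Sum>j\<in>A. if a = j then c * f a else 0)"
    by (intro sum.cong) auto
  then show ?thesis using A by simp
qed

lemma cross_cap_simps:
  "i \<in> {1..2*k-3} \<Longrightarrow> cross_cap k x i = x i"
  "cross_cap k x (2*k-2) = x (2*k-2) ^ k + (\<Sum>i=1..k-2. x i * x (2*k-2) ^ i)"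
  "cross_cap k x (2*k-1) = (\<Sum>i=1..k-1. x (k-2+i) * x (2*k-2) ^ i)"
  unfolding cross_cap_def Let_def target_vec_simps[OF k2]
  by (auto simp: target_vec_def)

lemma Uc_cross_cap: "1 \<le> i \<Longrightarrow> i \<le> k - 2 \<Longrightarrow> Uc (int k) (cross_cap k x) (int i) = x i"
  and Vc_cross_cap: "1 \<le> i \<Longrightarrow> i \<le> k - 1 \<Longrightarrow> Vc (int k) (cross_cap k x) (int i) = x (k - 2 + i)"
proof -
  show "Uc (int k) (cross_cap k x) (int i) = x i" if "1 \<le> i" "i \<le> k - 2"
    using that cross_cap_simps(1)[of i x] by (auto simp: Uc_def)
  have "nat (int k - 2 + int i) = k - 2 + i" using k2 by simp
  moreover have "cross_cap k x (k - 2 + i) = x (k - 2 + i)" if "1 \<le> i" "i \<le> k - 1"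
    using that k2 by (intro cross_cap_simps(1)) auto
  ultimately show "Vc (int k) (cross_cap k x) (int i) = x (k - 2 + i)" if "1 \<le> i" "i \<le> k - 1"
    using that k2 unfolding Vc_def by (simp only: if_P) simp
qed

lemma poly_dU_tail:
  "poly (dU_tail k X 1) y = of_nat k * y ^ (k - 1) + (\<Sum>i=1..k-2. of_nat i * Uc (int k) X (int i) * y ^ (i - 1))"
proof -
  have "poly (dU_tail k X 1) y = (\<Sum>i\<le>k. dUc k X (int i + 1) * y ^ i)"
    by (simp add: tail_poly_def poly_sum poly_monom)
  also have "{..k} = insert k {..k-1}" using k2 by auto
  also have "(\<Sum>i\<in>insert k {..k-1}. dUc k X (int i + 1) * y ^ i) = (\<Sum>i\<le>k-1. dUc k X (int i + 1) * y ^ i)"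
    using supported_dUc[of X] k2 by (subst sum.insert) (auto simp: supported_def)
  also have "\<dots> = (\<Sum>i=1..k. dUc k X (int i) * y ^ (i - 1))"
    using k2 by (intro sum.reindex_bij_witness[of _ "\<lambda>i. i - 1" Suc]) (auto simp: add.commute)
  also have "{1..k} = insert k (insert (k - 1) {1..k-2})" using k2 by auto
  also have "(\<Sum>i\<in>insert k (insert (k - 1) {1..k-2}). dUc k X (int i) * y ^ (i - 1)) =
      dUc k X (int k) * y ^ (k - 1) + (dUc k X (int (k - 1)) * y ^ (k - 1 - 1) + (\<Sum>i=1..k-2. dUc k X (int i) * y ^ (i - 1)))"
    using k2 by (subst sum.insert, simp, force, subst sum.insert, simp, force, simp)
  also have "\<dots> = of_nat k * y ^ (k - 1) + (\<Sum>i=1..k-2. of_nat i * Uc (int k) X (int i) * y ^ (i - 1))"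
    using k2 by (simp add: dUc_def coord_simps of_nat_diff)
  finally show ?thesis .
qed

lemma poly_dV_tail:
  "poly (dV_tail k X 1) y = (\<Sum>i=1..k-1. of_nat i * Vc (int k) X (int i) * y ^ (i - 1))"
proof -
  have "poly (dV_tail k X 1) y = (\<Sum>i\<le>k. dVc k X (int i + 1) * y ^ i)"
    by (simp add: tail_poly_def poly_sum poly_monom)
  also have "{..k} = insert k {..k-1}" using k2 by auto
  also have "(\<Sum>i\<in>insert k {..k-1}. dVc k X (int i + 1) * y ^ i) = (\<Sum>i\<le>k-1. dVc k X (int i + 1) * y ^ i)"
    using supported_dVc[of X] k2 by (subst sum.insert) (auto simp: supported_def)
  also have "\<dots> = (\<Sum>i=1..k. dVc k X (int i) * y ^ (i - 1))"
    using k2 by (intro sum.reindex_bij_witness[of _ "\<lambda>i. i - 1" Suc]) (auto simp: add.commute)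
  also have "{1..k} = insert k {1..k-1}" using k2 by auto
  also have "(\<Sum>i\<in>insert k {1..k-1}. dVc k X (int i) * y ^ (i - 1)) =
      (\<Sum>i=1..k-1. of_nat i * Vc (int k) X (int i) * y ^ (i - 1))"
    using k2 by (simp add: dVc_def coord_simps of_nat_diff)
  finally show ?thesis .
qed

lemma poly_field_poly1: "poly (field_poly1 k z) y = z (2*k-2) - (\<Sum>i=1..k-2. z i * y ^ i)"
  and poly_field_poly2: "poly (field_poly2 k z) y = z (2*k-1) - (\<Sum>i=1..k-1. z (k-2+i) * y ^ i)"
  by (simp_all add: field_poly1_def field_poly2_def poly_sum poly_monom)

lemma partial_deriv_cross_cap_coord:
  assumes "i \<in> {1..2*k-3}"
  shows "partial_deriv j (\<lambda>z. cross_cap k z i) x = (if i = j then 1 else 0)"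
  unfolding partial_deriv_def cross_cap_simps(1)[OF assms]
  by (rule DERIV_imp_deriv has_field_derivative_fun_upd)+

text \<open>The first 2k - 3 components of the map are coordinates, so there the lift agrees with
  the field. Inserting this into the last two rows and moving everything except the term of the
  y-component to one side produces the encoded polynomials at y.\<close>

lemma lift_equations:
  fixes x \<eta> :: "nat \<Rightarrow> 'a::real_normed_field"
  assumes lift: "\<forall>i\<in>{1..2*k-1}. (\<Sum>j=1..2*k-2. partial_deriv j (\<lambda>z. cross_cap k z i) x * \<eta> j) = Z i"
  shows "poly (field_poly1 k Z) (x (2*k-2)) = \<eta> (2*k-2) * poly (dU_tail k (cross_cap k x) 1) (x (2*k-2))"
    and "poly (field_poly2 k Z) (x (2*k-2)) = \<eta> (2*k-2) * poly (dV_tail k (cross_cap k x) 1) (x (2*k-2))"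
proof -
  let ?n = "2*k-2"
  let ?y = "x ?n"
  have Z: "Z i = \<eta> i" if "i \<in> {1..2*k-3}" for i
  proof -
    have "i \<in> {1..2*k-1}" using that by auto
    from bspec[OF lift this] have "Z i = (\<Sum>j=1..?n. (if i = j then 1 else 0) * \<eta> j)"
      unfolding partial_deriv_cross_cap_coord[OF that] by (rule sym)
    also have "\<dots> = \<eta> i" using that by (subst sum_delta_mult) auto
    finally show ?thesis .
  qed
  have n: "?n \<in> {1..?n}" using k2 by auto
  have d1: "partial_deriv j (\<lambda>z. cross_cap k z ?n) x = (\<Sum>i=1..k-2. (if i = j then ?y ^ i else 0))
      + (if ?n = j then poly (dU_tail k (cross_cap k x) 1) ?y else 0)" for j
  proof -
    note D = has_field_derivative_fun_upd[of x j _ "x j"]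
    have "((\<lambda>t. cross_cap k (x(j := t)) ?n) has_field_derivative
        of_nat k * ((if ?n = j then 1 else 0) * ?y ^ (k - Suc 0)) +
        (\<Sum>i=1..k-2. (if i = j then 1 else 0) * ?y ^ i + of_nat i * ((if ?n = j then 1 else 0) * ?y ^ (i - Suc 0)) * x i)) (at (x j))"
      unfolding cross_cap_simps(2)
      using DERIV_add[OF DERIV_power[OF D] DERIV_sum[OF DERIV_mult[OF D DERIV_power[OF D]]]]
      by (simp only: fun_upd_triv)
    note D' = DERIV_imp_deriv[OF this]
    have S: "(\<Sum>i=1..k-2. of_nat i * ((if ?n = j then 1 else 0) * ?y ^ (i - Suc 0)) * x (i)) =
        (if ?n = j then \<Sum>i=1..k-2. of_nat i * Uc (int k) (cross_cap k x) (int i) * ?y ^ (i - 1) else 0)"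
      by (cases "?n = j") (auto simp: Uc_cross_cap intro!: sum.cong)
    have S0: "(\<Sum>i=1..k-2. (if i = j then 1 else 0) * ?y ^ i) = (\<Sum>i=1..k-2. if i = j then ?y ^ i else 0)"
      by (intro sum.cong) auto
    show ?thesis
      unfolding partial_deriv_def D' sum.distrib S S0 poly_dU_tail
      by (cases "?n = j") simp_all
  qed
  have d2: "partial_deriv j (\<lambda>z. cross_cap k z (2*k-1)) x = (\<Sum>i=1..k-1. (if k - 2 + i = j then ?y ^ i else 0))
      + (if ?n = j then poly (dV_tail k (cross_cap k x) 1) ?y else 0)" for j
  proof -
    note D = has_field_derivative_fun_upd[of x j _ "x j"]
    have "((\<lambda>t. cross_cap k (x(j := t)) (2*k-1)) has_field_derivative
        (\<Sum>i=1..k-1. (if k - 2 + i = j then 1 else 0) * ?y ^ i + of_nat i * ((if ?n = j then 1 else 0) * ?y ^ (i - Suc 0)) * x (k-2+i))) (at (x j))"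
      unfolding cross_cap_simps(3)
      using DERIV_sum[OF DERIV_mult[OF D DERIV_power[OF D]]]
      by (simp only: fun_upd_triv)
    note D' = DERIV_imp_deriv[OF this]
    have S: "(\<Sum>i=1..k-1. of_nat i * ((if ?n = j then 1 else 0) * ?y ^ (i - Suc 0)) * x (k - 2 + i)) =
        (if ?n = j then \<Sum>i=1..k-1. of_nat i * Vc (int k) (cross_cap k x) (int i) * ?y ^ (i - 1) else 0)"
      by (cases "?n = j") (auto simp: Vc_cross_cap intro!: sum.cong)
    have S0: "(\<Sum>i=1..k-1. (if k - 2 + i = j then 1 else 0) * ?y ^ i) = (\<Sum>i=1..k-1. if k - 2 + i = j then ?y ^ i else 0)"
      by (intro sum.cong) auto
    show ?thesis
      unfolding partial_deriv_def D' sum.distrib S S0 poly_dV_tail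
      by (cases "?n = j") simp_all
  qed
  have "Z ?n = (\<Sum>j=1..?n. partial_deriv j (\<lambda>z. cross_cap k z ?n) x * \<eta> j)"
    by (rule bspec[OF lift, THEN sym]) (use k2 in auto)
  also have "\<dots> = (\<Sum>j=1..?n. \<Sum>i=1..k-2. (if i = j then ?y ^ i else 0) * \<eta> j)
     + (\<Sum>j=1..?n. (if ?n = j then poly (dU_tail k (cross_cap k x) 1) ?y else 0) * \<eta> j)"
    unfolding d1 by (simp only: distrib_right sum.distrib sum_distrib_right)
  also have "(\<Sum>j=1..?n. \<Sum>i=1..k-2. (if i = j then ?y ^ i else 0) * \<eta> j) = (\<Sum>i=1..k-2. ?y ^ i * \<eta> i)"
    by (subst sum.swap, intro sum.cong refl sum_delta_mult) auto
  also have "(\<Sum>j=1..?n. (if ?n = j then poly (dU_tail k (cross_cap k x) 1) ?y else 0) * \<eta> j) = poly (dU_tail k (cross_cap k x) 1) ?y * \<eta> ?n"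
    using n by (intro sum_delta_mult) auto
  finally have *: "Z ?n = (\<Sum>i=1..k-2. ?y ^ i * \<eta> i) + poly (dU_tail k (cross_cap k x) 1) ?y * \<eta> ?n" .
  show "poly (field_poly1 k Z) ?y = \<eta> ?n * poly (dU_tail k (cross_cap k x) 1) ?y"
  proof -
    have "(\<Sum>i=1..k-2. Z i * ?y ^ i) = (\<Sum>i=1..k-2. ?y ^ i * \<eta> i)"
      by (intro sum.cong refl) (auto simp: Z)
    then show ?thesis using * unfolding poly_field_poly1 by simp
  qed
  have "Z (2*k-1) = (\<Sum>j=1..?n. partial_deriv j (\<lambda>z. cross_cap k z (2*k-1)) x * \<eta> j)"
    by (rule bspec[OF lift, THEN sym]) (use k2 in auto)
  also have "\<dots> = (\<Sum>j=1..?n. \<Sum>i=1..k-1. (if k - 2 + i = j then ?y ^ i else 0) * \<eta> j)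
     + (\<Sum>j=1..?n. (if ?n = j then poly (dV_tail k (cross_cap k x) 1) ?y else 0) * \<eta> j)"
    unfolding d2 by (simp only: distrib_right sum.distrib sum_distrib_right)
  also have "(\<Sum>j=1..?n. \<Sum>i=1..k-1. (if k - 2 + i = j then ?y ^ i else 0) * \<eta> j) = (\<Sum>i=1..k-1. ?y ^ i * \<eta> (k - 2 + i))"
    by (subst sum.swap, intro sum.cong refl sum_delta_mult) auto
  also have "(\<Sum>j=1..?n. (if ?n = j then poly (dV_tail k (cross_cap k x) 1) ?y else 0) * \<eta> j) = poly (dV_tail k (cross_cap k x) 1) ?y * \<eta> ?n"
    using n by (intro sum_delta_mult) auto
  finally have *: "Z (2*k-1) = (\<Sum>i=1..k-1. ?y ^ i * \<eta> (k - 2 + i)) + poly (dV_tail k (cross_cap k x) 1) ?y * \<eta> ?n" .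
  show "poly (field_poly2 k Z) ?y = \<eta> ?n * poly (dV_tail k (cross_cap k x) 1) ?y"
  proof -
    have "(\<Sum>i=1..k-1. Z (k - 2 + i) * ?y ^ i) = (\<Sum>i=1..k-1. ?y ^ i * \<eta> (k - 2 + i))"
    proof (intro sum.cong refl)
      fix i assume "i \<in> {1..k-1}"
      then have "Z (k - 2 + i) = \<eta> (k - 2 + i)" by (intro Z) auto
      then show "Z (k - 2 + i) * ?y ^ i = ?y ^ i * \<eta> (k - 2 + i)" by (simp only: mult.commute)
    qed
    then show ?thesis using * unfolding poly_field_poly2 by simp
  qed
qed

section \<open>Points of the source and vanishing near the origin\<close>

definition graph_point where
  "graph_point X y = X(2*k-1 := poly (V_tail k X 0) y, 2*k-2 := poly (U_tail k X 0) y)"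

text \<open>Lets pairs (X, y) stand for points (u, v, y) of the source: W1 and W2 are forgotten, and
  for \<open>X\<close> in \<open>Kn (2*k-1)\<close> the image under \<open>cross_cap\<close> is
  \<open>graph_point X y\<close>.\<close>

definition source_point where
  "source_point X y = (\<lambda>i. if i \<in> {1..2*k-3} then X i else if i = 2*k-2 then y else 0)"

lemma Uc_upd: "m > k - 2 \<Longrightarrow> Uc (int k) (X(m := c)) r = Uc (int k) X r"
  and Vc_upd: "m > 2*k - 3 \<Longrightarrow> Vc (int k) (X(m := c)) r = Vc (int k) X r"
  using k2 by (auto simp: Uc_def Vc_def)

lemma coords_graph_point:
  "Uc (int k) (graph_point X y) = Uc (int k) X" "Vc (int k) (graph_point X y) = Vc (int k) X"
  "dUc k (graph_point X y) = dUc k X" "dVc k (graph_point X y) = dVc k X"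
proof -
  show *: "Uc (int k) (graph_point X y) = Uc (int k) X" "Vc (int k) (graph_point X y) = Vc (int k) X"
    using k2 by (auto simp: graph_point_def Uc_upd Vc_upd fun_eq_iff)
  show "dUc k (graph_point X y) = dUc k X" "dVc k (graph_point X y) = dVc k X"
    by (simp_all add: dUc_def dVc_def fun_eq_iff *)
qed

lemma poly_U_tail_0: "poly (U_tail k X 0) y = y ^ k + (\<Sum>i=1..k-2. Uc (int k) X (int i) * y ^ i)"
proof -
  have "poly (U_tail k X 0) y = (\<Sum>i\<le>k. Uc (int k) X (int i) * y ^ i)"
    by (simp add: tail_poly_def poly_sum poly_monom)
  also have "{..k} = insert k (insert (k - 1) (insert 0 {1..k-2}))" using k2 by auto
  also have "(\<Sum>i\<in>insert k (insert (k - 1) (insert 0 {1..k-2})). Uc (int k) X (int i) * y ^ i) =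
      Uc (int k) X (int k) * y ^ k + (Uc (int k) X (int (k - 1)) * y ^ (k - 1) + (\<Sum>i\<in>insert 0 {1..k-2}. Uc (int k) X (int i) * y ^ i))"
    using k2 by (subst sum.insert, simp, force, subst sum.insert, simp, force, simp)
  finally show ?thesis
    using k2 by (simp add: coord_simps of_nat_diff)
qed

lemma poly_V_tail_0: "poly (V_tail k X 0) y = (\<Sum>i=1..k-1. Vc (int k) X (int i) * y ^ i)"
proof -
  have "poly (V_tail k X 0) y = (\<Sum>i\<le>k. Vc (int k) X (int i) * y ^ i)"
    by (simp add: tail_poly_def poly_sum poly_monom)
  also have "{..k} = insert k (insert 0 {1..k-1})" using k2 by auto
  finally show ?thesis
    using k2 by (simp add:)
qed

lemma source_point_Kn: "source_point X y \<in> Kn (2*k-2)"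
  using k2 by (auto simp: source_point_def Kn_def)

lemma cross_cap_source_point:
  assumes "X \<in> Kn (2*k-1)"
  shows "cross_cap k (source_point X y) = graph_point X y"
proof
  fix i
  have U: "Uc (int k) X (int j) = X j" if "j \<in> {1..k-2}" for j
    using that by (auto simp: Uc_def)
  have V: "Vc (int k) X (int j) = X (k-2+j)" if "j \<in> {1..k-1}" for j
  proof -
    have "nat (int k - 2 + int j) = k - 2 + j" using k2 by simp
    then show ?thesis using that by (auto simp: Vc_def)
  qed
  consider "i \<in> {1..2*k-3}" | "i = 2*k-2" | "i = 2*k-1" | "i \<notin> {1..2*k-1}" by force
  then show "cross_cap k (source_point X y) i = graph_point X y i"
  proof cases
    case 1
    then have "i \<noteq> 2*k-2" "i \<noteq> 2*k-1" by auto
    then show ?thesis using 1 by (simp add: cross_cap_simps(1) source_point_def graph_point_def)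
  next
    case 2
    have "(\<Sum>j=1..k-2. source_point X y j * source_point X y (2*k-2) ^ j) = (\<Sum>j=1..k-2. Uc (int k) X (int j) * y ^ j)"
      by (intro sum.cong refl) (use k2 in \<open>auto simp: U source_point_def\<close>)
    moreover have "source_point X y (2*k-2) = y" by (auto simp: source_point_def)
    ultimately show ?thesis unfolding 2 cross_cap_simps(2) by (simp add: graph_point_def poly_U_tail_0)
  next
    case 3
    have "2*k-1 \<noteq> 2*k-2" using k2 by linarith
    moreover have "(\<Sum>j=1..k-1. source_point X y (k-2+j) * source_point X y (2*k-2) ^ j) = (\<Sum>j=1..k-1. Vc (int k) X (int j) * y ^ j)"
      by (intro sum.cong refl) (use k2 in \<open>auto simp: V source_point_def\<close>)
    ultimately show ?thesis unfolding 3 cross_cap_simps(3) by (simp add: graph_point_def poly_V_tail_0)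
  next
    case 4
    have "i \<notin> {1..k-2}" "i \<notin> {k-1..2*k-3}" "i \<noteq> 2*k-2" "i \<noteq> 2*k-1" "X i = 0"
      using 4 k2 assms unfolding Kn_def by auto
    then show ?thesis
      unfolding cross_cap_def Let_def target_vec_def graph_point_def by (simp only: if_False fun_upd_apply)
  qed
qed

lemma source_point_last [simp]: "source_point X y (2*k-2) = y"
  by (auto simp: source_point_def)

text \<open>Eliminates W1 by p and W2 by q. The quotients belong to W1 - p and W2 - q, whereas
  \<open>W1_rel\<close> and \<open>W2_rel\<close> have the opposite sign; hence the negations in the
  witnesses.\<close>

lemma poly_family_restrict_graph:
  fixes F :: "(nat \<Rightarrow> 'a::real_normed_field) \<Rightarrow> 'a poly"
  assumes "poly_family (2*k-1) F"
  obtains F0 G1 G2 where "poly_family (2*k-1) F0" "poly_family (2*k-1) G1" "poly_family (2*k-1) G2"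
    "\<And>X. F X = F0 X + W1_rel k X * G1 X + W2_rel k X * G2 X"
    "\<And>X y. poly (F0 X) y = poly (F (graph_point X y)) y"
proof -
  obtain F' G where 1: "poly_family (2*k-1) F'" "poly_family (2*k-1) G"
    "\<And>X. F X = F' X + ([:X (2*k-2):] - U_tail k X 0) * G X"
    "\<And>X y. poly (F' X) y = poly (F (X(2*k-2 := poly (U_tail k X 0) y))) y"
    by (rule poly_family_subst[OF assms poly_family_tails(1)]) (rule that)
  obtain F'' G' where 2: "poly_family (2*k-1) F''" "poly_family (2*k-1) G'"
    "\<And>X. F' X = F'' X + ([:X (2*k-1):] - V_tail k X 0) * G' X"
    "\<And>X y. poly (F'' X) y = poly (F' (X(2*k-1 := poly (V_tail k X 0) y))) y"
    by (rule poly_family_subst[OF 1(1) poly_family_tails(2)]) (rule that)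
  have W: "W1c (int k) X = X (2*k-2)" "W2c (int k) X = X (2*k-1)" for X :: "nat \<Rightarrow> 'a"
    unfolding W1c_def W2c_def using k2 by (simp_all add: nat_diff_distrib nat_mult_distrib)
  \<comment> \<open>p does not involve W2, so the two successive substitutions amount to evaluating
    at \<open>graph_point\<close>.\<close>
  have "Uc (int k) (X(2*k-1 := c)) = Uc (int k) X" for X :: "nat \<Rightarrow> 'a" and c
    using k2 by (auto simp: Uc_upd fun_eq_iff)
  then have F: "poly (F'' X) y = poly (F (graph_point X y)) y" for X y
    unfolding 2(4) 1(4) graph_point_def by simp
  have F': "F X = F'' X + W1_rel k X * (- G X) + W2_rel k X * (- G' X)" for X
    unfolding 1(3) 2(3) W by (simp add: algebra_simps)
  show thesis
    by (rule that[of F'' "\<lambda>X. - G X" "\<lambda>X. - G' X"])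
       (rule 2(1) poly_family_uminus[OF 1(2)] poly_family_uminus[OF 2(2)] F F')+
qed

text \<open>Along the line the family is a polynomial in t; infinitely many zeros make it zero, and
  t = 1 gives the claim.\<close>

lemma poly_family_eq_0_curve:
  fixes F :: "(nat \<Rightarrow> 'a::real_normed_field) \<Rightarrow> 'a poly"
  assumes "poly_family n F" "infinite {t. poly (F (\<lambda>i. t * X i)) (t * y) = 0}"
  shows "poly (F X) y = 0"
proof -
  obtain P where P: "\<And>t. poly P t = poly (F (\<lambda>i. t * X i)) (t * y)"
    using poly_family_along_line[OF assms(1)] by blast
  have "P = 0"
    using assms(2) poly_roots_finite[of P] unfolding P by blast
  then show ?thesis using P[of 1] by simp
qed

text \<open>Scaling by small t moves any pair (X, y) into the neighbourhood, so vanishing near the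
  origin spreads to all of \<open>Kn\<close> and all y.\<close>

lemma poly_family_eq_0:
  assumes "poly_family n F" "nbhd0 (2*k-2) S" "X \<in> Kn (2*k-1)"
    and 0: "\<And>X y. X \<in> Kn (2*k-1) \<Longrightarrow> source_point X y \<in> S \<Longrightarrow> poly (F X) y = 0"
  shows "F X = 0"
proof (rule iffD1[OF poly_all_0_iff_0], rule allI)
  fix y
  have "infinite {t. source_point (\<lambda>i. t * X i) (t * y) \<in> S}"
  proof (rule infinite_curve_in_nbhd0[OF assms(2) source_point_Kn])
    show "continuous_on UNIV (\<lambda>t. source_point (\<lambda>i. t * X i) (t * y) i)" for i
    proof -
      have "(\<lambda>t. source_point (\<lambda>i. t * X i) (t * y) i) = (\<lambda>t. t * source_point X y i)"
        by (auto simp: source_point_def)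
      then show ?thesis by (simp only:) (rule continuous_on_mult[OF continuous_on_id continuous_on_const])
    qed
  qed (auto simp: source_point_def)
  moreover have "(\<lambda>i. t * X i) \<in> Kn (2*k-1)" for t
    using assms(3) by (auto simp: Kn_def)
  ultimately have "infinite {t. poly (F (\<lambda>i. t * X i)) (t * y) = 0}"
    using 0 by (elim infinite_super[rotated]) auto
  then show "poly (F X) y = 0"
    by (rule poly_family_eq_0_curve[OF assms(1)])
qed

lemma source_point_scale:
  fixes t :: "'a::real_normed_field"
  shows "source_point (\<lambda>i. t * X i) (t * y) i = t * source_point X y i"
  by (simp add: source_point_def)

lemma source_point_upd: "m \<in> {1..2*k-3} \<Longrightarrow> source_point (X(m := c)) y = (source_point X y)(m := c)"
  by (auto simp: source_point_def fun_eq_iff)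

text \<open>For k >= 3 the zero set of p' is the graph of U_1 = \<open>t\<close> over the other
  coordinates and y. Restricting \<open>F\<close> to it gives \<open>Fo\<close>, which vanishes near
  the origin and hence everywhere, and the difference is a multiple of p'. For k = 2 there is no U_1
  and p' = 2 y.\<close>

lemma divide_by_derivative:
  fixes F :: "(nat \<Rightarrow> 'a::real_normed_field) \<Rightarrow> 'a poly"
  assumes "poly_family (2*k-1) F" and S: "nbhd0 (2*k-2) S"
    and 0: "\<And>X y. X \<in> Kn (2*k-1) \<Longrightarrow> source_point X y \<in> S \<Longrightarrow> poly (dU_tail k X 1) y = 0 \<Longrightarrow> poly (F X) y = 0"
  shows "\<exists>h. poly_family (2*k-1) h \<and> (\<forall>X\<in>Kn (2*k-1). F X = h X * dU_tail k X 1)"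
proof (cases "k = 2")
  case True
  have dU_tail: "dU_tail k X 1 = smult 2 [:0, 1:]" for X :: "nat \<Rightarrow> 'a"
  proof (rule poly_eqI)
    show "coeff (dU_tail k X 1) n = coeff (smult 2 [:0, 1:]) n" for n
      unfolding coeff_tails using True by (auto simp: dUc_def Uc_def coeff_pCons split: nat.split)
  qed
  have "poly_family (2*k-1) (\<lambda>X. [:0, 1 :: 'a:])" by (rule poly_family.var)
  from poly_family_divide_monic[OF assms(1) this, of 1]
  obtain R E where RE: "poly_family (2*k-1) R" "poly_family (2*k-1) E"
    "\<And>X. degree (R X) < 1 \<or> R X = 0" "\<And>X. F X = R X + [:0, 1:] * E X" by auto
  \<comment> \<open>\<open>R\<close> does not involve y, so it suffices to look at y = 0, the zero
    of p'.\<close>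
  have "R X = 0" if X: "X \<in> Kn (2*k-1)" for X
  proof -
    have "infinite {t. source_point (\<lambda>i. t * X i) (t * 0) \<in> S}"
    proof (rule infinite_curve_in_nbhd0[OF S source_point_Kn])
      show "continuous_on UNIV (\<lambda>t. source_point (\<lambda>i. t * X i) (t * 0) i)" for i
        unfolding source_point_scale by (rule continuous_on_mult[OF continuous_on_id continuous_on_const])
    qed (auto simp: source_point_def)
    moreover have "(\<lambda>i. t * X i) \<in> Kn (2*k-1)" for t
      using X by (auto simp: Kn_def)
    ultimately have "infinite {t. poly (F (\<lambda>i. t * X i)) (t * 0) = 0}"
      using 0 by (elim infinite_super[rotated]) (auto simp: dU_tail simp del: One_nat_def)
    then have "poly (F X) 0 = 0"
      by (rule poly_family_eq_0_curve[OF assms(1)])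
    then have "coeff (R X) 0 = 0" by (simp add: RE(4) poly_0_coeff_0)
    then show ?thesis using RE(3)[of X] by (metis degree_eq_zeroE coeff_pCons_0 less_one pCons_0_0)
  qed
  then have "\<forall>X\<in>Kn (2*k-1). F X = smult (1/2) (E X) * dU_tail k X 1"
    using RE(4) by (simp add: dU_tail mult.commute del: One_nat_def)
  then show ?thesis
    using poly_family_smult[OF polynomial_fun.const RE(2)] by blast
next
  case False
  then have k3: "k \<ge> 3" using k2 by simp
  define t where "t X = [:X 1:] - dU_tail k X 1" for X :: "nat \<Rightarrow> 'a"
  have t: "poly_family (2*k-1) t"
    unfolding t_def using k2 by (intro poly_family_diff poly_family.coord poly_family_tails) auto
  have one: "1 \<in> {1..2*k-3}" "1 \<in> {1..2*k-1}" using k3 by auto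
  \<comment> \<open>\<open>t\<close> is the value of \<open>U\<^sub>1\<close> for which \<open>p'\<close> vanishes at \<open>y\<close>\<close>
  have root: "poly (dU_tail k (X(1 := poly (t X) y)) 1) y = 0" for X y
  proof -
    have *: "poly (dU_tail k Z 1) y = Z 1 + (of_nat k * y ^ (k - 1) + (\<Sum>i=2..k-2. of_nat i * Uc (int k) Z (int i) * y ^ (i - 1)))" for Z
    proof -
      have "{1..k-2} = insert 1 {2..k-2}" using k3 by auto
      then show ?thesis unfolding poly_dU_tail using k3 by (simp add: Uc_def)
    qed
    have "Uc (int k) (X(1 := c)) (int i) = Uc (int k) X (int i)" if "i \<ge> 2" for i c
      using that by (auto simp: Uc_def)
    then show ?thesis
      unfolding * by (simp add: t_def *[unfolded One_nat_def])
  qed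
  obtain Fo G where Fo: "poly_family (2*k-1) Fo" "poly_family (2*k-1) G"
    "\<And>X. F X = Fo X + ([:X 1:] - t X) * G X" "\<And>X y. poly (Fo X) y = poly (F (X(1 := poly (t X) y))) y"
    by (rule poly_family_subst[OF assms(1) t]) (rule that)
  have "Fo X = 0" if X: "X \<in> Kn (2*k-1)" for X
  proof (rule iffD1[OF poly_all_0_iff_0], rule allI)
    fix y
    \<comment> \<open>The line through (X, y), with U_1 bent so that p' stays zero at s y; the other
      coordinates remain linear in s.\<close>
    define Z where "Z s = (\<lambda>i. s * X i)(1 := poly (t (\<lambda>i. s * X i)) (s * y))" for s
    have Z: "Z s \<in> Kn (2*k-1)" for s
      using X one by (auto simp: Z_def Kn_def)
    obtain P where P: "\<And>s. poly P s = poly (t (\<lambda>i. s * X i)) (s * y)"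
      using poly_family_along_line[OF t] by blast
    have sZ: "source_point (Z s) (s * y) i = (if i = 1 then poly P s else s * source_point X y i)" for s i
      unfolding Z_def source_point_upd[OF one(1)] P fun_upd_apply source_point_scale ..
    have "(\<Sum>i=1..k-2. of_nat i * Uc (int k) (\<lambda>_. 0 :: 'a) (int i) * 0 ^ (i - 1)) = 0"
      by (intro sum.neutral ballI) (auto simp: Uc_def)
    \<comment> \<open>The exponent k - 1 is positive, so p' vanishes at the origin and the bent
      curve passes through it.\<close>
    then have "poly (dU_tail k (\<lambda>_. 0 :: 'a) 1) 0 = 0"
      unfolding poly_dU_tail using k3 by simp
    then have "poly P 0 = 0"
      by (simp add: P t_def del: One_nat_def)
    have "infinite {s. source_point (Z s) (s * y) \<in> S}"
    proof (rule infinite_curve_in_nbhd0[OF S source_point_Kn])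
      show "source_point (Z 0) (0 * y) = origin"
      proof
        show "source_point (Z 0) (0 * y) i = 0" for i
          unfolding sZ using \<open>poly P 0 = 0\<close> by simp
      qed
      show "continuous_on UNIV (\<lambda>s. source_point (Z s) (s * y) i)" for i
        unfolding sZ by (cases "i = 1") (auto intro!: continuous_intros)
    qed
    then have "infinite {s. poly (Fo (\<lambda>i. s * X i)) (s * y) = 0}"
      by (rule infinite_super[rotated]) (use 0[OF Z] root in \<open>auto simp: Fo(4) Z_def simp del: One_nat_def\<close>)
    then show "poly (Fo X) y = 0"
      by (rule poly_family_eq_0_curve[OF Fo(1)])
  qed
  then have "\<forall>X\<in>Kn (2*k-1). F X = G X * dU_tail k X 1"
    using Fo(3) by (simp add: t_def mult.commute del: One_nat_def)
  then show ?thesis using Fo(2) by blast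
qed

text \<open>On the graph both equations contain the same unknown value of the lift. The first yields
  a polynomial \<open>h\<close>; eliminating the lift between the two gives p' R2 = q' R1, and
  cancelling p' shows that this \<open>h\<close> serves the second equation as well.\<close>

lemma liftable_decomposition:
  fixes \<xi> \<eta> :: "(nat \<Rightarrow> 'a::real_normed_field) \<Rightarrow> nat \<Rightarrow> 'a"
  assumes S: "nbhd0 (2*k-2) S"
    and lift: "\<And>x. x \<in> S \<Longrightarrow> \<forall>i\<in>{1..2*k-1}.
        (\<Sum>j=1..2*k-2. partial_deriv j (\<lambda>z. cross_cap k z i) x * \<eta> x j) = \<xi> (cross_cap k x) i"
    and poly: "\<forall>m\<in>{1..2*k-1}. polynomial_fun (2*k-1) (\<lambda>X. \<xi> X m)"
  obtains h e1 e2 g1 g2 where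
    "poly_family (2*k-1) h" "poly_family (2*k-1) e1" "poly_family (2*k-1) e2"
    "poly_family (2*k-1) g1" "poly_family (2*k-1) g2"
    "\<And>X. X \<in> Kn (2*k-1) \<Longrightarrow> field_poly1 k (\<xi> X) = h X * dU_tail k X 1 + W1_rel k X * e1 X + W2_rel k X * g1 X"
    "\<And>X. X \<in> Kn (2*k-1) \<Longrightarrow> field_poly2 k (\<xi> X) = h X * dV_tail k X 1 + W1_rel k X * e2 X + W2_rel k X * g2 X"
proof -
  have m: "polynomial_fun (2*k-1) (\<lambda>X. \<xi> X m)" if "1 \<le> m" "m \<le> 2*k-1" for m
    using poly that by auto
  have F1: "poly_family (2*k-1) (\<lambda>X. field_poly1 k (\<xi> X))"
    unfolding field_poly1_def using k2
    by (intro poly_family_diff poly_family_sum poly_family_monom poly_family_coeff_const m) auto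
  have F2: "poly_family (2*k-1) (\<lambda>X. field_poly2 k (\<xi> X))"
    unfolding field_poly2_def using k2
    by (intro poly_family_diff poly_family_sum poly_family_monom poly_family_coeff_const m) auto
  obtain R1 e1 g1 where 1: "poly_family (2*k-1) R1" "poly_family (2*k-1) e1" "poly_family (2*k-1) g1"
    "\<And>X. field_poly1 k (\<xi> X) = R1 X + W1_rel k X * e1 X + W2_rel k X * g1 X"
    "\<And>X y. poly (R1 X) y = poly (field_poly1 k (\<xi> (graph_point X y))) y"
    by (rule poly_family_restrict_graph[OF F1]) (rule that)
  obtain R2 e2 g2 where 2: "poly_family (2*k-1) R2" "poly_family (2*k-1) e2" "poly_family (2*k-1) g2"
    "\<And>X. field_poly2 k (\<xi> X) = R2 X + W1_rel k X * e2 X + W2_rel k X * g2 X"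
    "\<And>X y. poly (R2 X) y = poly (field_poly2 k (\<xi> (graph_point X y))) y"
    by (rule poly_family_restrict_graph[OF F2]) (rule that)
  have R: "poly (R1 X) y = \<eta> (source_point X y) (2*k-2) * poly (dU_tail k X 1) y"
    "poly (R2 X) y = \<eta> (source_point X y) (2*k-2) * poly (dV_tail k X 1) y"
    if "X \<in> Kn (2*k-1)" "source_point X y \<in> S" for X y
    using lift_equations[OF lift[OF that(2)]]
    unfolding cross_cap_source_point[OF that(1)] source_point_last 1(5) 2(5) coords_graph_point
    by simp_all
  obtain h where h: "poly_family (2*k-1) h" "\<And>X. X \<in> Kn (2*k-1) \<Longrightarrow> R1 X = h X * dU_tail k X 1"
    using divide_by_derivative[OF 1(1) S] R(1) by auto
  have "R2 X = h X * dV_tail k X 1" if X: "X \<in> Kn (2*k-1)" for X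
  proof -
    \<comment> \<open>The factor p' makes the identity hold near the origin also at zeros of p',
      where \<open>h\<close> need not agree with the lift.\<close>
    have "dU_tail k X 1 * (R2 X - h X * dV_tail k X 1) = 0"
    proof (rule poly_family_eq_0[OF _ S X])
      show "poly_family (2*k-1) (\<lambda>X. dU_tail k X 1 * (R2 X - h X * dV_tail k X 1))"
        by (intro poly_family.mult poly_family_diff poly_family_tails 2 h)
      show "poly (dU_tail k X 1 * (R2 X - h X * dV_tail k X 1)) y = 0"
        if "X \<in> Kn (2*k-1)" "source_point X y \<in> S" for X y
      proof -
        have "poly (dU_tail k X 1) y * poly (R2 X) y = poly (R1 X) y * poly (dV_tail k X 1) y"
          unfolding R[OF that] by (simp only: mult_ac)
        then show ?thesis
          unfolding h(2)[OF that(1)] poly_mult poly_diff right_diff_distrib by (simp only: mult_ac) simp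
      qed
    qed
    moreover have "dU_tail k X 1 \<noteq> 0"
      using dU_tail_triangular(2)[of "k - 1" X] k2 by auto
    ultimately show ?thesis by simp
  qed
  then show thesis
    using that[OF h(1) 1(2) 2(2) 1(3) 2(3)] 1(4) 2(4) h(2) by simp
qed

end

theorem theorem3p5:
  fixes k :: nat
    and reg :: "nat \<Rightarrow> ((nat \<Rightarrow> 'a::real_normed_field) \<Rightarrow> 'a) \<Rightarrow> bool"
    and \<xi> :: "(nat \<Rightarrow> 'a) \<Rightarrow> nat \<Rightarrow> 'a"
  assumes "k \<ge> 2"
    and "reg = smooth_germ \<or> reg = analytic_germ"
    and "liftable reg (2*k-2) (2*k-1) (cross_cap k) \<xi>"
    and "\<forall>m\<in>{1..2*k-1}. polynomial_fun (2*k-1) (\<lambda>X. \<xi> X m)"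
  shows "\<exists>g_e g. polynomial_fun (2*k-1) g_e \<and>
           (\<forall>i\<in>{1..3}. \<forall>j\<in>{1..k-1}. polynomial_fun (2*k-1) (g i j)) \<and>
           (\<forall>X\<in>Kn (2*k-1). \<forall>m\<in>{1..2*k-1}.
              \<xi> X m = g_e X * euler_field k X m +
                (\<Sum>i=1..3. \<Sum>j=1..k-1. g i j X * family_field k i j X m))"
proof -
  obtain \<eta> S where S: "nbhd0 (2*k-2) S" and lift: "\<And>x. x \<in> S \<Longrightarrow> \<forall>i\<in>{1..2*k-1}.
      (\<Sum>j=1..2*k-2. partial_deriv j (\<lambda>z. cross_cap k z i) x * \<eta> x j) = \<xi> (cross_cap k x) i"
    using assms(3) unfolding liftable_def by blast
  show ?thesis
    by (rule liftable_decomposition[OF assms(1) S _ assms(4)], rule lift, assumption)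
       (rule decomposition_imp_generated[OF assms(1)])
qed

end
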